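(* Let $s\in(0,1)$ and let $\mathcal I_{\rm sym}$ be a translation invariant, positively $1$-homogeneous operator which is elliptic with respect to the set of symmetric kernels $\mathcal{K}_{\rm sym}$ (see context). Let $f:(0,\infty)\to\mathbb{R}$ be a continuous non-increasing function. Then there exists no non-constant positive viscosity solution $u$ to $$-\mathcal I_{\rm sym}u=f(u)\quad\text{in }\mathbb{R}^n$$ satisfying $|u(x)|\leq C(1+|x|)^\gamma$ for all $x\in\mathbb{R}^n$ (for some constant $C$), provided one of the following holds: (i) $\gamma<\min\{1,2s\}$; (ii) $s>\frac12$ and $f$ is a $C^1$ convex function satisfying $$\limsup_{R\to\infty}R^{2s-(2-\beta)\gamma}\,|f'(R^\gamma)|^{\frac{2s-1}{2s}}=\infty$$ for some $\beta\in(0,1)$.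
   Context: Fix $s\in(0,1)$ and $0<\lambda\leq\Lambda$. $\mathcal{K}_{\rm sym}=\mathcal{K}_{\rm sym}(\lambda,\Lambda)$ is the family of measurable kernels $K:\mathbb{R}^n\setminus\{0\}\to[0,\infty)$ with $\frac{\lambda}{|z|^{n+2s}}\leq K(z)\leq\frac{\Lambda}{|z|^{n+2s}}$ and $K(z)=K(-z)$ for $z\neq0$. With $B$ the unit ball centered at $0$, put $$L_Ku(x)=\int_{\mathbb{R}^n}\big[u(x+z)-u(x)-1_{\{2s\in[1,2)\}}1_B(z)\nabla u(x)\cdot z\big]K(z)\,dz .$$ Let $\omega_s(z)=(1+|z|)^{-n-2s}$, and let $L^1(\omega_s)$ be the functions integrable against $\omega_s$. $\mathcal I_{\rm sym}$ is a nonlocal operator which is translation invariant ($\mathcal I_{\rm sym}u_h(x)=\mathcal I_{\rm sym}u(x+h)$ for all $x,h$, where $u_h=u(\cdot+h)$), positively $1$-homogeneous, and elliptic with respect to $\mathcal{K}_{\rm sym}$, i.e. $$\inf_{K\in\mathcal{K}_{\rm sym}}(L_Ku(x)-L_Kv(x))\leq\mathcal I_{\rm sym}u(x)-\mathcal I_{\rm sym}v(x)\leq\sup_{K\in\mathcal{K}_{\rm sym}}(L_Ku(x)-L_Kv(x))$$ whenever $u,v\in C^{1,1}(x)\cap L^1(\omega_s)$ (where $C^{1,1}(x)$ means $C^{1,1}$ at the point $x$). Viscosity solutions: let $\Omega\subseteq\mathbb{R}^n$ and $U\subseteq\mathbb{R}$ be open and consider $-\mathcal I_{\rm sym}u+H(x,u,\nabla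 u)=0$ in $\Omega$, with $H\in C(\mathbb{R}^n\times U\times\mathbb{R}^n)$. A measurable $u:\mathbb{R}^n\to U$ in $L^1(\omega_s)$, upper (resp. lower) semicontinuous in $\bar\Omega$, is a viscosity subsolution (resp. supersolution) if for each $x_0\in\Omega$ and $\varphi\in C^2(B_r(x_0))$, for some $r>0$, with $u(x_0)=\varphi(x_0)$ and $u\leq\varphi$ (resp. $u\geq\varphi$) in $B_r(x_0)$, one has $-\mathcal I_{\rm sym}v(x_0)+H(x_0,u(x_0),\nabla\varphi(x_0))\leq0$ (resp. $\geq0$), where $v=\varphi$ in $B_r(x_0)$ and $v=u$ elsewhere. A viscosity solution is both a sub- and a supersolution. *)

theory Defs
  imports "HOL-Analysis.Analysis"
begin

text \<open>The space \<open>\<real>\<^sup>n\<close> is a type \<open>'a\<close> of class \<open>euclidean_space\<close>, with \<open>n = DIM('a)\<close>.\<close>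

definition grad :: "('a::euclidean_space \<Rightarrow> real) \<Rightarrow> 'a \<Rightarrow> 'a" where
  "grad u x = (THE p. GDERIV u x :> p)"

text \<open>Kernels are defined on \<open>\<real>\<^sup>n\<close> minus the origin; the value of \<open>K\<close> at \<open>0\<close> is left
  unconstrained.\<close>

definition K_sym :: "real \<Rightarrow> real \<Rightarrow> real \<Rightarrow> ('a::euclidean_space \<Rightarrow> real) set" where
  "K_sym s l L = {K. K \<in> borel_measurable (lebesgue_on (- {0})) \<and>
     (\<forall>z. z \<noteq> 0 \<longrightarrow> 0 \<le> K z \<and>
        l / norm z powr (real DIM('a) + 2 * s) \<le> K z \<and>
        K z \<le> L / norm z powr (real DIM('a) + 2 * s) \<and>
        K z = K (- z))}"

definition L_op :: "real \<Rightarrow> ('a::euclidean_space \<Rightarrow> real) \<Rightarrow> ('a \<Rightarrow> real) \<Rightarrow> 'a \<Rightarrow> real" where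
  "L_op s K u x =
     (LINT z|lebesgue. (u (x + z) - u x
        - indicator {1..<2} (2 * s) * indicator (ball 0 1) z * (grad u x \<bullet> z)) * K z)"

definition omega :: "real \<Rightarrow> 'a::euclidean_space \<Rightarrow> real" where
  "omega s z = (1 + norm z) powr (- real DIM('a) - 2 * s)"

definition L1_omega :: "real \<Rightarrow> ('a::euclidean_space \<Rightarrow> real) set" where
  "L1_omega s = {u. u \<in> borel_measurable lebesgue \<and> integrable lebesgue (\<lambda>z. u z * omega s z)}"

text \<open>\<open>C\<^sup>1\<^sup>,\<^sup>1\<close> at the single point \<open>x\<close>, in the sense of Caffarelli and Silvestre: a first-order
  expansion at \<open>x\<close> with quadratic error.\<close>

definition C11_at :: "'a::euclidean_space \<Rightarrow> ('a \<Rightarrow> real) set" where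
  "C11_at x = {u. \<exists>p M r. r > 0 \<and>
     (\<forall>z. norm z < r \<longrightarrow> \<bar>u (x + z) - u x - p \<bullet> z\<bar> \<le> M * (norm z)\<^sup>2)}"

text \<open>An operator is a total function here, but \<open>I u x\<close> is meaningful only for
  \<open>u \<in> C11_at x \<inter> L1_omega s\<close>, so each property below is required on that class only.\<close>

definition translation_invariant_op ::
    "real \<Rightarrow> (('a::euclidean_space \<Rightarrow> real) \<Rightarrow> 'a \<Rightarrow> real) \<Rightarrow> bool" where
  "translation_invariant_op s I \<longleftrightarrow>
     (\<forall>u x h. u \<in> C11_at (x + h) \<inter> L1_omega s \<longrightarrow> I (\<lambda>y. u (y + h)) x = I u (x + h))"

definition pos_homogeneous_op ::
    "real \<Rightarrow> (('a::euclidean_space \<Rightarrow> real) \<Rightarrow> 'a \<Rightarrow> real) \<Rightarrow> bool" where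
  "pos_homogeneous_op s I \<longleftrightarrow>
     (\<forall>u x t. u \<in> C11_at x \<inter> L1_omega s \<and> t > 0 \<longrightarrow> I (\<lambda>y. t * u y) x = t * I u x)"

text \<open>For such \<open>u\<close> and \<open>v\<close>, the differences are bounded uniformly in \<open>K\<close>
  by the upper kernel bound, and the family of kernels is nonempty when \<open>0 < l \<le> L\<close>, so the
  real-valued infimum and supremum are the genuine ones.\<close>

definition elliptic_op ::
    "real \<Rightarrow> real \<Rightarrow> real \<Rightarrow> (('a::euclidean_space \<Rightarrow> real) \<Rightarrow> 'a \<Rightarrow> real) \<Rightarrow> bool" where
  "elliptic_op s l L I \<longleftrightarrow>
     (\<forall>u v x. u \<in> C11_at x \<inter> L1_omega s \<and> v \<in> C11_at x \<inter> L1_omega s \<longrightarrow>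
        (INF K\<in>K_sym s l L. L_op s K u x - L_op s K v x) \<le> I u x - I v x \<and>
        I u x - I v x \<le> (SUP K\<in>K_sym s l L. L_op s K u x - L_op s K v x))"

definition usc_on :: "'a::topological_space set \<Rightarrow> ('a \<Rightarrow> real) \<Rightarrow> bool" where
  "usc_on S u \<longleftrightarrow> (\<forall>x\<in>S. \<forall>a>u x. \<forall>\<^sub>F y in at x within S. u y < a)"

definition lsc_on :: "'a::topological_space set \<Rightarrow> ('a \<Rightarrow> real) \<Rightarrow> bool" where
  "lsc_on S u \<longleftrightarrow> (\<forall>x\<in>S. \<forall>a<u x. \<forall>\<^sub>F y in at x within S. a < u y)"

text \<open>\<open>C\<^sup>2\<close> on an open set: \<open>G\<close> is the gradient and \<open>D\<close> the (continuous) Hessian.\<close>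

definition C2_on :: "'a::euclidean_space set \<Rightarrow> ('a \<Rightarrow> real) \<Rightarrow> bool" where
  "C2_on S \<phi> \<longleftrightarrow>
     (\<exists>(G :: 'a \<Rightarrow> 'a) (D :: 'a \<Rightarrow> 'a \<Rightarrow>\<^sub>L 'a).
        (\<forall>x\<in>S. (GDERIV \<phi> x :> G x) \<and> (G has_derivative blinfun_apply (D x)) (at x)) \<and>
        continuous_on S D)"

definition glue ::
    "'a::euclidean_space \<Rightarrow> real \<Rightarrow> ('a \<Rightarrow> real) \<Rightarrow> ('a \<Rightarrow> real) \<Rightarrow> 'a \<Rightarrow> real" where
  "glue x0 r \<phi> u = (\<lambda>x. if x \<in> ball x0 r then \<phi> x else u x)"

text \<open>Viscosity sub- and supersolutions of \<open>- I u + H (x, u, \<nabla>u) = 0\<close> in \<open>\<Omega>\<close> with values in \<open>U\<close>.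
  A test function \<open>\<phi>\<close> that is \<open>C\<^sup>2\<close> in the open ball may fail to be integrable up to its boundary,
  and then \<open>I\<close> is not defined at the glued function; such \<open>\<phi>\<close> are admitted only after
  decreasing \<open>r\<close>, which is what the last condition on \<open>\<phi>\<close> expresses.\<close>

definition visc_subsol ::
    "real \<Rightarrow> (('a::euclidean_space \<Rightarrow> real) \<Rightarrow> 'a \<Rightarrow> real) \<Rightarrow> 'a set \<Rightarrow> real set \<Rightarrow>
     ('a \<Rightarrow> real \<Rightarrow> 'a \<Rightarrow> real) \<Rightarrow> ('a \<Rightarrow> real) \<Rightarrow> bool" where
  "visc_subsol s I \<Omega> U H u \<longleftrightarrow>
     u \<in> L1_omega s \<and> range u \<subseteq> U \<and> usc_on (closure \<Omega>) u \<and>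
     (\<forall>x0\<in>\<Omega>. \<forall>r>0. \<forall>\<phi>.
        C2_on (ball x0 r) \<phi> \<and> u x0 = \<phi> x0 \<and> (\<forall>x\<in>ball x0 r. u x \<le> \<phi> x) \<and>
        glue x0 r \<phi> u \<in> L1_omega s
        \<longrightarrow> - I (glue x0 r \<phi> u) x0 + H x0 (u x0) (grad \<phi> x0) \<le> 0)"

definition visc_supersol ::
    "real \<Rightarrow> (('a::euclidean_space \<Rightarrow> real) \<Rightarrow> 'a \<Rightarrow> real) \<Rightarrow> 'a set \<Rightarrow> real set \<Rightarrow>
     ('a \<Rightarrow> real \<Rightarrow> 'a \<Rightarrow> real) \<Rightarrow> ('a \<Rightarrow> real) \<Rightarrow> bool" where
  "visc_supersol s I \<Omega> U H u \<longleftrightarrow>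
     u \<in> L1_omega s \<and> range u \<subseteq> U \<and> lsc_on (closure \<Omega>) u \<and>
     (\<forall>x0\<in>\<Omega>. \<forall>r>0. \<forall>\<phi>.
        C2_on (ball x0 r) \<phi> \<and> u x0 = \<phi> x0 \<and> (\<forall>x\<in>ball x0 r. u x \<ge> \<phi> x) \<and>
        glue x0 r \<phi> u \<in> L1_omega s
        \<longrightarrow> - I (glue x0 r \<phi> u) x0 + H x0 (u x0) (grad \<phi> x0) \<ge> 0)"

definition visc_sol ::
    "real \<Rightarrow> (('a::euclidean_space \<Rightarrow> real) \<Rightarrow> 'a \<Rightarrow> real) \<Rightarrow> 'a set \<Rightarrow> real set \<Rightarrow>
     ('a \<Rightarrow> real \<Rightarrow> 'a \<Rightarrow> real) \<Rightarrow> ('a \<Rightarrow> real) \<Rightarrow> bool" where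
  "visc_sol s I \<Omega> U H u \<longleftrightarrow> visc_subsol s I \<Omega> U H u \<and> visc_supersol s I \<Omega> U H u"

end

theory Submission
  imports Defs
begin

text \<open>The proof doubles the variables in the manner of Ishii and Lions. If \<open>u x\<^sub>0 > u y\<^sub>0\<close>, maximise
  \<open>u x - u y - E |x - y|\<^sup>\<alpha> - T ((R\<^sup>2 + |x|\<^sup>2)\<^bsup>\<sigma>/2\<^esup> - R\<^sup>\<sigma>)\<close> with \<open>\<gamma> < \<sigma> < 2 s\<close>, \<open>T \<approx> R\<^bsup>\<gamma>-\<sigma>\<^esup>\<close> and \<open>\<alpha> < 1\<close>; positivity of
  \<open>u\<close> and the growth bound confine the maximum to \<open>|x| \<le> R\<close>. At the maximum point, with \<open>b = |x - y|\<close>,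
  ellipticity and the concavity of \<open>t\<^sup>\<alpha>\<close> give
  \<open>f (u y) - f (u x) + c E b\<^bsup>\<alpha>-2s\<^esup> \<le> D R\<^bsup>\<gamma>-2s\<^esup>\<close>, the right-hand side being the cost of the penalty.
  For \<open>\<gamma> < min 1 (2 s)\<close> take \<open>\<gamma> < \<alpha>\<close> and \<open>E \<approx> R\<^bsup>\<gamma>-\<alpha>\<^esup>\<close>, so that \<open>b \<le> R\<close> and the inequality fails. In the
  convex case the left-hand side is at least \<open>E (m b\<^sup>\<alpha> + c b\<^bsup>\<alpha>-2s\<^esup>)\<close>, hence of order
  \<open>E m\<^bsup>(2s-\<alpha>)/(2s)\<^esup>\<close> with \<open>m \<approx> |f' (R\<^sup>\<gamma>)|\<close>; the limsup condition yields radii for which this beats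
  \<open>R\<^bsup>\<gamma>-2s\<^esup>\<close> with some \<open>E \<rightarrow> 0\<close>, once \<open>\<alpha>\<close> is close enough to \<open>1\<close>. In both cases \<open>E \<rightarrow> 0\<close> as \<open>R \<rightarrow> \<infinity>\<close>, so the
  maximum is eventually positive.\<close>

subsection \<open>Lebesgue integrals of radial powers\<close>

text \<open>The scale \<open>c\<close> with absolute value 1 treats translations
  (\<open>c = 1\<close>) and the reflection (\<open>c = -1\<close>) by one affine change of
  variables, whose Jacobian is 1.\<close>

lemma lebesgue_shift_reflect_distr:
  fixes t :: "'a::euclidean_space" and c :: real
  assumes "\<bar>c\<bar> = 1"
  shows "distr lebesgue lebesgue (\<lambda>x. t + c *\<^sub>R x) = lebesgue"
    and "(\<lambda>x. t + c *\<^sub>R x) \<in> lebesgue \<rightarrow>\<^sub>M lebesgue"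
proof -
  have T: "t + (\<Sum>j\<in>Basis. (c * (x \<bullet> j)) *\<^sub>R j) = t + c *\<^sub>R x" for x :: 'a
    by (simp add: euclidean_representation flip: scaleR_scaleR scaleR_right.sum)
  have c: "c \<noteq> 0" using assms by auto
  show "distr lebesgue lebesgue (\<lambda>x. t + c *\<^sub>R x) = lebesgue"
    using lebesgue_affine_euclidean[of "\<lambda>_. c" t] c assms
    by (simp add: T density_1)
  show "(\<lambda>x. t + c *\<^sub>R x) \<in> lebesgue \<rightarrow>\<^sub>M lebesgue"
    using lebesgue_affine_measurable[of "\<lambda>_. c" t] c by (simp add: T)
qed

lemma lebesgue_shift_measurable [measurable]:
  "(\<lambda>x. t + x) \<in> lebesgue \<rightarrow>\<^sub>M (lebesgue :: 'a::euclidean_space measure)"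
  using lebesgue_shift_reflect_distr(2)[of 1 t] by simp

lemma lebesgue_uminus_measurable [measurable]:
  "uminus \<in> lebesgue \<rightarrow>\<^sub>M (lebesgue :: 'a::euclidean_space measure)"
  using lebesgue_shift_reflect_distr(2)[of "-1" "0::'a"] by (simp add: fun_Compl_def)

lemma lebesgue_integrable_shift:
  fixes g :: "'a::euclidean_space \<Rightarrow> real"
  assumes "integrable lebesgue g"
  shows "integrable lebesgue (\<lambda>x. g (t + x))"
  using integrable_distr[OF lebesgue_shift_reflect_distr(2)[of 1 t], of g]
    lebesgue_shift_reflect_distr(1)[of 1 t] assms by simp

lemma lebesgue_integral_reflect:
  fixes g :: "'a::euclidean_space \<Rightarrow> real"
  assumes "integrable lebesgue g"
  shows "integrable lebesgue (\<lambda>x. g (- x))" 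
    and "(LINT x|lebesgue. g (- x)) = (LINT x|lebesgue. g x)"
proof -
  have d: "distr lebesgue lebesgue uminus = (lebesgue :: 'a measure)"
    using lebesgue_shift_reflect_distr(1)[of "-1" "0::'a"] by (simp add: fun_Compl_def)
  show "integrable lebesgue (\<lambda>x. g (- x))"
    using integrable_distr[OF lebesgue_uminus_measurable, of g] d assms by simp
  have "g \<in> borel_measurable lebesgue" using assms by auto
  then show "(LINT x|lebesgue. g (- x)) = (LINT x|lebesgue. g x)"
    using integral_distr[OF lebesgue_uminus_measurable, of g] d by simp
qed

lemma borel_measurable_lebesgue:
  "g \<in> borel_measurable borel \<Longrightarrow> g \<in> borel_measurable (lebesgue :: 'a::euclidean_space measure)"
  by (rule measurable_completion) (simp only: measurable_lborel2)

text \<open>Dyadic shells shrinking to the origin: on each shell numerator and denominator are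
  estimated separately by monotonicity, and the shell bounds form a geometric series of ratio
  \<open>q\<close>, below 1 because the total exponent is positive. The constant is chosen before
  \<open>R\<close>, so the estimate carries the exact scaling in \<open>R\<close>.\<close>

lemma nn_integral_near_origin:
  fixes a b :: real
  assumes "0 \<le> a" "0 \<le> b" "real DIM('a::euclidean_space) + a - b > 0"
  shows "\<exists>c\<ge>0. \<forall>R>0. (\<integral>\<^sup>+z. ennreal (norm z powr a / norm z powr b * indicator (ball 0 R) z) \<partial>(lebesgue :: 'a measure))
            \<le> ennreal (c * R powr (real DIM('a) + a - b))"
proof -
  let ?n = "real DIM('a)"
  define e where "e = ?n + a - b"
  define q where "q = (1/2) powr e"
  define V where "V = unit_ball_vol ?n * 2 powr b"
  have q: "0 < q" "q < 1" 
    using assms(3) powr01_less_one[of "1/2" e] by (auto simp: q_def e_def)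
  have V: "0 \<le> V" by (simp add: V_def)
  have "(\<integral>\<^sup>+z. ennreal (norm z powr a / norm z powr b * indicator (ball 0 R) z) \<partial>(lebesgue :: 'a measure))
            \<le> ennreal (V / (1 - q) * R powr e)" if R: "R > 0" for R
  proof -
    define r where "r k = R * (1/2)^k" for k :: nat
    have r: "r k > 0" for k using R by (simp add: r_def)
    have rS: "r (Suc k) = r k / 2" for k by (simp add: r_def)
    \<comment> \<open>The majorant of the shell between \<open>r (Suc k)\<close> and
      \<open>r k\<close> is spread over the whole ball: only an upper bound is needed, and the
      volume of a ball is explicit.\<close>
    define h where "h k z = r k powr a / r (Suc k) powr b * indicator (ball 0 (r k)) z" for k and z :: 'a
    have [measurable]: "ball (0::'a) (r k) \<in> sets borel" for k by simp
    have pw: "ennreal (norm z powr a / norm z powr b * indicator (ball 0 R) z) \<le> (\<Sum>k. ennreal (h k z))" for z :: 'a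
    proof (cases "z \<noteq> 0 \<and> norm z < R")
      case False
      then show ?thesis by (auto simp: indicator_def)
    next
      case True
      then have nz: "norm z > 0" by simp
      have "\<exists>k. r k \<le> norm z"
      proof -
        obtain k where "(1/2::real)^k < norm z / R"
          using real_arch_pow_inv[of "norm z / R" "1/2"] nz R by auto
        then show ?thesis using R by (intro exI[of _ k]) (simp add: r_def field_simps)
      qed
      define k where "k = (LEAST k. r k \<le> norm z)"
      have k: "r k \<le> norm z" unfolding k_def by (rule LeastI_ex) fact
      have "k \<noteq> 0" using k True by (intro notI) (simp add: r_def)
      then obtain j where j: "k = Suc j" by (cases k) auto
      have rj: "norm z < r j"
        using not_less_Least[of j "\<lambda>k. r k \<le> norm z"] j k_def by auto
      have "norm z powr a / norm z powr b \<le> r j powr a / r (Suc j) powr b"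
        using k j rj r[of "Suc j"] nz assms
        by (intro frac_le powr_mono2) auto
      also have "\<dots> = h j z" using rj by (simp add: h_def)
      finally have "ennreal (norm z powr a / norm z powr b * indicator (ball 0 R) z) \<le> ennreal (h j z)"
        using True by (intro ennreal_leI) (simp add: indicator_def)
      also have "\<dots> \<le> (\<Sum>k. ennreal (h k z))"
        using sum_le_suminf[of "\<lambda>k. ennreal (h k z)" "{j}"] by simp
      finally show ?thesis .
    qed
    have hi: "(\<integral>\<^sup>+z. ennreal (h k z) \<partial>lebesgue) = ennreal (V * R powr e * q ^ k)" for k
    proof -
      have "(\<integral>\<^sup>+z. ennreal (h k z) \<partial>lebesgue) =
          (\<integral>\<^sup>+z. ennreal (r k powr a / r (Suc k) powr b) * indicator (ball 0 (r k)) (z::'a) \<partial>lebesgue)"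
        unfolding h_def by (intro nn_integral_cong) (auto simp: indicator_def)
      also have "\<dots> = ennreal (r k powr a / r (Suc k) powr b) * ennreal (unit_ball_vol ?n * r k ^ DIM('a))"
        using r[of k] by (subst nn_integral_cmult_indicator) (auto simp: emeasure_ball)
      also have "\<dots> = ennreal (r k powr a / r (Suc k) powr b * (unit_ball_vol ?n * r k ^ DIM('a)))"
        using r[of k] by (intro ennreal_mult[symmetric]) auto
      also have "r k powr a / r (Suc k) powr b * (unit_ball_vol ?n * r k ^ DIM('a)) = V * r k powr e"
        using r[of k] unfolding e_def rS V_def
        by (simp add: powr_add powr_diff powr_divide powr_realpow)
      also have "r k powr e = R powr e * q ^ k"
      proof -
        have "q ^ k = (1/2::real) powr (e * real k)"
          using q by (simp add: q_def powr_powr flip: powr_realpow)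
        also have "\<dots> = ((1/2::real) ^ k) powr e"
          by (simp add: powr_powr mult.commute flip: powr_realpow)
        finally show ?thesis using R by (simp add: r_def powr_mult)
      qed
      finally show ?thesis by (simp add: mult.assoc)
    qed
    have "(\<integral>\<^sup>+z. ennreal (norm z powr a / norm z powr b * indicator (ball 0 R) z) \<partial>(lebesgue :: 'a measure))
        \<le> (\<integral>\<^sup>+z. (\<Sum>k. ennreal (h k z)) \<partial>lebesgue)"
      by (intro nn_integral_mono pw)
    also have "\<dots> = (\<Sum>k. \<integral>\<^sup>+z. ennreal (h k z) \<partial>lebesgue)"
      by (intro nn_integral_suminf measurable_compose_rev[OF measurable_ennreal] borel_measurable_lebesgue)
        (unfold h_def, measurable)
    also have "\<dots> = (\<Sum>k. ennreal (V * R powr e * q ^ k))" by (simp add: hi)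
    also have "\<dots> = ennreal (V * R powr e * (1 / (1 - q)))"
      using q V by (intro suminf_ennreal_eq sums_mult geometric_sums) auto
    finally show ?thesis by (simp only: times_divide_eq_right times_divide_eq_left mult_1_right)
  qed
  then show ?thesis using V q unfolding e_def
    by (intro exI[of _ "V / (1 - q)"]) auto
qed

text \<open>The same dyadic argument with shells growing outwards; the negative total exponent now
  makes the ratio \<open>2 powr e\<close> less than 1.\<close>

lemma nn_integral_far_from_origin:
  fixes a b :: real
  assumes "0 \<le> a" "0 \<le> b" "real DIM('a::euclidean_space) + a - b < 0"
  shows "\<exists>c\<ge>0. \<forall>R>0. (\<integral>\<^sup>+z. ennreal (norm z powr a / norm z powr b * indicator (- ball 0 R) z) \<partial>(lebesgue :: 'a measure))
            \<le> ennreal (c * R powr (real DIM('a) + a - b))"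
proof -
  let ?n = "real DIM('a)"
  define e where "e = ?n + a - b"
  define q where "q = 2 powr e"
  define V where "V = unit_ball_vol ?n * 2 powr (a + ?n)"
  have e: "e < 0" using assms(3) by (simp add: e_def)
  have q: "0 < q" "q < 1"
    unfolding q_def using e by (simp, intro powr_less_one, simp_all)
  have V: "0 \<le> V" by (simp add: V_def)
  have "(\<integral>\<^sup>+z. ennreal (norm z powr a / norm z powr b * indicator (- ball 0 R) z) \<partial>(lebesgue :: 'a measure))
            \<le> ennreal (V / (1 - q) * R powr e)" if R: "R > 0" for R
  proof -
    define r where "r k = R * 2^k" for k :: nat
    have r: "r k > 0" for k using R by (simp add: r_def)
    have rS: "r (Suc k) = 2 * r k" for k by (simp add: r_def)
    define h where "h k z = r (Suc k) powr a / r k powr b * indicator (ball 0 (r (Suc k))) z" for k and z :: 'a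
    have [measurable]: "ball (0::'a) (r k) \<in> sets borel" for k by simp
    have pw: "ennreal (norm z powr a / norm z powr b * indicator (- ball 0 R) z) \<le> (\<Sum>k. ennreal (h k z))" for z :: 'a
    proof (cases "norm z \<ge> R")
      case False
      then show ?thesis by (auto simp: indicator_def)
    next
      case True
      then have nz: "norm z > 0" using R by linarith
      have "\<exists>k. norm z < r k"
      proof -
        obtain k where "norm z / R < (2::real)^k"
          using real_arch_pow[of 2 "norm z / R"] by auto
        then show ?thesis using R by (intro exI[of _ k]) (simp add: r_def field_simps)
      qed
      define k where "k = (LEAST k. norm z < r k)"
      have k: "norm z < r k" unfolding k_def by (rule LeastI_ex) fact
      have "k \<noteq> 0" using k True by (intro notI) (simp add: r_def)
      then obtain j where j: "k = Suc j" by (cases k) auto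
      have rj: "r j \<le> norm z"
        using not_less_Least[of j "\<lambda>k. norm z < r k"] j k_def by auto
      have "norm z powr a / norm z powr b \<le> r (Suc j) powr a / r j powr b"
        using k j rj r[of "j"] nz assms
        by (intro frac_le powr_mono2) auto
      also have "\<dots> = h j z" using k j by (simp add: h_def)
      finally have "ennreal (norm z powr a / norm z powr b * indicator (- ball 0 R) z) \<le> ennreal (h j z)"
        using True by (intro ennreal_leI) (simp add: indicator_def)
      also have "\<dots> \<le> (\<Sum>k. ennreal (h k z))"
        using sum_le_suminf[of "\<lambda>k. ennreal (h k z)" "{j}"] by simp
      finally show ?thesis .
    qed
    have hi: "(\<integral>\<^sup>+z. ennreal (h k z) \<partial>lebesgue) = ennreal (V * R powr e * q ^ k)" for k
    proof -
      have "(\<integral>\<^sup>+z. ennreal (h k z) \<partial>lebesgue) =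
          (\<integral>\<^sup>+z. ennreal (r (Suc k) powr a / r k powr b) * indicator (ball 0 (r (Suc k))) (z::'a) \<partial>lebesgue)"
        unfolding h_def by (intro nn_integral_cong) (auto simp: indicator_def)
      also have "\<dots> = ennreal (r (Suc k) powr a / r k powr b) * ennreal (unit_ball_vol ?n * r (Suc k) ^ DIM('a))"
        using r[of "Suc k"] by (subst nn_integral_cmult_indicator) (auto simp: emeasure_ball)
      also have "\<dots> = ennreal (r (Suc k) powr a / r k powr b * (unit_ball_vol ?n * r (Suc k) ^ DIM('a)))"
        using r[of "Suc k"] by (intro ennreal_mult[symmetric]) auto
      also have "r (Suc k) powr a / r k powr b * (unit_ball_vol ?n * r (Suc k) ^ DIM('a)) = V * r k powr e"
        using r[of k] unfolding e_def rS V_def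
        by (simp add: powr_add powr_diff powr_mult powr_realpow power_mult_distrib)
      also have "r k powr e = R powr e * q ^ k"
      proof -
        have "q ^ k = (2::real) powr (e * real k)"
          using q by (simp add: q_def powr_powr flip: powr_realpow)
        also have "\<dots> = ((2::real) ^ k) powr e"
          by (simp add: powr_powr mult.commute flip: powr_realpow)
        finally show ?thesis using R by (simp add: r_def powr_mult)
      qed
      finally show ?thesis by (simp add: mult.assoc)
    qed
    have "(\<integral>\<^sup>+z. ennreal (norm z powr a / norm z powr b * indicator (- ball 0 R) z) \<partial>(lebesgue :: 'a measure))
        \<le> (\<integral>\<^sup>+z. (\<Sum>k. ennreal (h k z)) \<partial>lebesgue)"
      by (intro nn_integral_mono pw)
    also have "\<dots> = (\<Sum>k. \<integral>\<^sup>+z. ennreal (h k z) \<partial>lebesgue)"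
      by (intro nn_integral_suminf measurable_compose_rev[OF measurable_ennreal] borel_measurable_lebesgue)
        (unfold h_def, measurable)
    also have "\<dots> = (\<Sum>k. ennreal (V * R powr e * q ^ k))" by (simp add: hi)
    also have "\<dots> = ennreal (V * R powr e * (1 / (1 - q)))"
      using q V by (intro suminf_ennreal_eq sums_mult geometric_sums) auto
    finally show ?thesis by (simp only: times_divide_eq_right times_divide_eq_left mult_1_right)
  qed
  then show ?thesis using V q unfolding e_def
    by (intro exI[of _ "V / (1 - q)"]) auto
qed

lemma integral_le_of_nn_integral_le:
  fixes g :: "'b \<Rightarrow> real"
  assumes [measurable]: "g \<in> borel_measurable M" and "\<And>x. 0 \<le> g x"
    and "(\<integral>\<^sup>+x. ennreal (g x) \<partial>M) \<le> ennreal c" "0 \<le> c"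
  shows "integrable M g" "integral\<^sup>L M g \<le> c"
proof -
  have "(\<integral>\<^sup>+x. ennreal (g x) \<partial>M) < \<infinity>" by (rule le_less_trans[OF assms(3)]) simp
  then show i: "integrable M g" using assms(2) by (intro integrableI_nonneg) auto
  show "integral\<^sup>L M g \<le> c"
    using nn_integral_eq_integral[OF i] assms(2-4) by (metis AE_I2 ennreal_le_iff)
qed

lemma integral_near_origin:
  fixes a b :: real
  assumes "0 \<le> a" "0 \<le> b" "real DIM('a::euclidean_space) + a - b > 0"
  shows "\<exists>c\<ge>0. \<forall>R>0. integrable lebesgue (\<lambda>z::'a. norm z powr a / norm z powr b * indicator (ball 0 R) z) \<and>
     (LINT z|lebesgue. norm z powr a / norm (z::'a) powr b * indicator (ball 0 R) z)
            \<le> c * R powr (real DIM('a) + a - b)"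
proof -
  obtain c where c: "c \<ge> 0" "\<And>R. R > 0 \<Longrightarrow> (\<integral>\<^sup>+z. ennreal (norm z powr a / norm z powr b * indicator (ball 0 R) z) \<partial>(lebesgue :: 'a measure))
            \<le> ennreal (c * R powr (real DIM('a) + a - b))"
    using nn_integral_near_origin[OF assms] by blast
  have "integrable lebesgue (\<lambda>z::'a. norm z powr a / norm z powr b * indicator (ball 0 R) z)"
    "(LINT z|lebesgue. norm z powr a / norm (z::'a) powr b * indicator (ball 0 R) z)
            \<le> c * R powr (real DIM('a) + a - b)" if "R > 0" for R
  proof -
    have [measurable]: "ball (0::'a) R \<in> sets borel" by simp
    have m: "(\<lambda>z::'a. norm z powr a / norm z powr b * indicator (ball 0 R) z) \<in> borel_measurable lebesgue"
      by (intro borel_measurable_lebesgue) measurable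
    show "integrable lebesgue (\<lambda>z::'a. norm z powr a / norm z powr b * indicator (ball 0 R) z)"
      "(LINT z|lebesgue. norm z powr a / norm (z::'a) powr b * indicator (ball 0 R) z)
            \<le> c * R powr (real DIM('a) + a - b)"
      by (rule integral_le_of_nn_integral_le[OF m _ c(2)[OF that]]; use c(1) in simp)+
  qed
  then show ?thesis using c(1) by blast
qed

lemma integral_far_from_origin:
  fixes a b :: real
  assumes "0 \<le> a" "0 \<le> b" "real DIM('a::euclidean_space) + a - b < 0"
  shows "\<exists>c\<ge>0. \<forall>R>0. integrable lebesgue (\<lambda>z::'a. norm z powr a / norm z powr b * indicator (- ball 0 R) z) \<and>
     (LINT z|lebesgue. norm z powr a / norm (z::'a) powr b * indicator (- ball 0 R) z)
            \<le> c * R powr (real DIM('a) + a - b)"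
proof -
  obtain c where c: "c \<ge> 0" "\<And>R. R > 0 \<Longrightarrow> (\<integral>\<^sup>+z. ennreal (norm z powr a / norm z powr b * indicator (- ball 0 R) z) \<partial>(lebesgue :: 'a measure))
            \<le> ennreal (c * R powr (real DIM('a) + a - b))"
    using nn_integral_far_from_origin[OF assms] by blast
  have "integrable lebesgue (\<lambda>z::'a. norm z powr a / norm z powr b * indicator (- ball 0 R) z)"
    "(LINT z|lebesgue. norm z powr a / norm (z::'a) powr b * indicator (- ball 0 R) z)
            \<le> c * R powr (real DIM('a) + a - b)" if "R > 0" for R
  proof -
    have [measurable]: "ball (0::'a) R \<in> sets borel" by simp
    have m: "(\<lambda>z::'a. norm z powr a / norm z powr b * indicator (- ball 0 R) z) \<in> borel_measurable lebesgue"
      by (intro borel_measurable_lebesgue) measurable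
    show "integrable lebesgue (\<lambda>z::'a. norm z powr a / norm z powr b * indicator (- ball 0 R) z)"
      "(LINT z|lebesgue. norm z powr a / norm (z::'a) powr b * indicator (- ball 0 R) z)
            \<le> c * R powr (real DIM('a) + a - b)"
      by (rule integral_le_of_nn_integral_le[OF m _ c(2)[OF that]]; use c(1) in simp)+
  qed
  then show ?thesis using c(1) by blast
qed

subsection \<open>Powers of the distance and second-order expansions\<close>

text \<open>Concavity of the power: after division by \<open>A powr p\<close> this is the tangent at
  1, that is, Young's inequality with second factor 1. The point \<open>B = 0\<close> is checked by
  hand.\<close>

lemma powr_le_tangent:
  fixes A B p :: real
  assumes "0 < A" "0 \<le> B" "0 < p" "p \<le> 1"
  shows "B powr p \<le> A powr p + p * A powr (p - 1) * (B - A)"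
proof -
  have "B powr p * (1 / A powr p) = (B / A) powr p"
    using assms by (simp add: powr_divide)
  also have "(B / A) powr p \<le> 1 + p * (B / A - 1)"
  proof -
    have "(B / A) powr p * 1 powr (1 - p) \<le> p * (B / A) + (1 - p) * 1" if "B > 0"
      using assms that by (intro Youngs_inequality_0) auto
    then show ?thesis using assms by (cases "B = 0") (auto simp: algebra_simps)
  qed
  finally have "B powr p \<le> A powr p * (1 + p * (B / A - 1))"
    using assms by (simp add: field_simps)
  also have "\<dots> = A powr p + p * A powr (p - 1) * (B - A)"
    using assms by (simp add: powr_diff field_simps)
  finally show ?thesis .
qed

text \<open>By the mean value theorem the power climbs less on [1, 3/2] than on [1/2, 1], so the sum
  at 3/2 and 1/2 is strictly below 2; continuity keeps half of the gap when both points are raised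
  by \<open>2*\<rho>\<close>. The points are the relative lengths of \<open>a + 2z\<close> and
  \<open>a - 2z\<close> at \<open>z = a/4\<close>, and \<open>\<rho>\<close> allows a whole ball of
  such \<open>z\<close>.\<close>

lemma powr_midpoint_gap:
  fixes \<alpha> :: real
  assumes "0 < \<alpha>" "\<alpha> < 1"
  shows "\<exists>\<rho> c. 0 < \<rho> \<and> \<rho> < 1/8 \<and> 0 < c \<and> (3/2 + 2*\<rho>) powr \<alpha> + (1/2 + 2*\<rho>) powr \<alpha> \<le> 2 - c"
proof -
  have d: "((\<lambda>t. t powr \<alpha>) has_real_derivative \<alpha> * t powr (\<alpha> - 1)) (at t)" if "t > 0" for t :: real
    using that by (auto intro!: derivative_eq_intros)
  obtain \<xi> where xi: "1 < \<xi>" "\<xi> < 3/2" "(3/2) powr \<alpha> - 1 powr \<alpha> = (3/2 - 1) * (\<alpha> * \<xi> powr (\<alpha> - 1))"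
    using MVT2[of 1 "3/2" "\<lambda>t. t powr \<alpha>" "\<lambda>t. \<alpha> * t powr (\<alpha> - 1)"] d by force
  obtain \<eta> where eta: "1/2 < \<eta>" "\<eta> < 1" "1 powr \<alpha> - (1/2) powr \<alpha> = (1 - 1/2) * (\<alpha> * \<eta> powr (\<alpha> - 1))"
    using MVT2[of "1/2" 1 "\<lambda>t. t powr \<alpha>" "\<lambda>t. \<alpha> * t powr (\<alpha> - 1)"] d by force
  have "\<xi> powr (\<alpha> - 1) < \<eta> powr (\<alpha> - 1)"
    using xi eta assms by (intro powr_less_mono2_neg) auto
  then have lt: "(3/2) powr \<alpha> + (1/2) powr \<alpha> < 2" 
  proof -
    have "\<alpha> * \<xi> powr (\<alpha> - 1) < \<alpha> * \<eta> powr (\<alpha> - 1)"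
      by (intro mult_strict_left_mono) fact+
    then show ?thesis using xi(3) eta(3) by (simp add: field_simps)
  qed
  define g where "g t = (3/2 + 2*t) powr \<alpha> + (1/2 + 2*t) powr \<alpha>" for t :: real
  define c where "c = (2 - g 0) / 2"
  have c: "c > 0" "g 0 < 2 - c" using lt unfolding c_def g_def by (simp_all add: field_simps)
  have "(g \<longlongrightarrow> g 0) (at_right 0)" unfolding g_def by (auto intro!: tendsto_eq_intros)
  then have "\<forall>\<^sub>F t in at_right 0. g t < 2 - c" using c(2) by (rule order_tendstoD)
  moreover have "\<forall>\<^sub>F t in at_right 0. t < (1/8::real)" by (intro eventually_at_rightI[of 0 "1/8"]) auto
  moreover have "\<forall>\<^sub>F t in at_right 0. (0::real) < t" by (simp add: eventually_at_right_less)
  ultimately have "\<forall>\<^sub>F t in at_right 0. g t < 2 - c \<and> t < 1/8 \<and> 0 < t"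
    by eventually_elim auto
  then obtain \<rho> where "g \<rho> < 2 - c" "\<rho> < 1/8" "0 < \<rho>"
    using eventually_happens by fastforce
  then show ?thesis using c(1) unfolding g_def
    by (intro exI[of _ \<rho>] exI[of _ c]) simp
qed

text \<open>A power of a quadratic polynomial: \<open>c = 0\<close> gives the modulus of continuity
  and \<open>c = R^2\<close> the growth penalty, so smoothness and second differences are treated
  once for both.\<close>

definition rpow :: "real \<Rightarrow> 'a::euclidean_space \<Rightarrow> real \<Rightarrow> 'a \<Rightarrow> real" where
  "rpow c y p x = (c + (norm (x - y))\<^sup>2) powr p"

lemma rpow_zero: "rpow 0 y (\<alpha> / 2) x = norm (x - y) powr \<alpha>"
  by (simp add: rpow_def powr_powr flip: powr_numeral)

text \<open>The tangent bound is applied to the squared distances, whose linear parts in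
  \<open>z\<close> cancel in the symmetric sum. Only the base point must be nonsingular, so
  \<open>z\<close> may be arbitrarily large.\<close>

lemma rpow_second_difference_le:
  assumes "0 \<le> c" "0 < p" "p \<le> 1" "0 < c + (norm (x - y))\<^sup>2"
  shows "rpow c y p (x + z) + rpow c y p (x - z) - 2 * rpow c y p x
           \<le> 2 * p * (c + (norm (x - y))\<^sup>2) powr (p - 1) * (norm z)\<^sup>2"
proof -
  let ?A = "c + (norm (x - y))\<^sup>2"
  have e: "(norm (x + z - y))\<^sup>2 = (norm (x - y))\<^sup>2 + 2 * ((x - y) \<bullet> z) + (norm z)\<^sup>2"
    "(norm (x - z - y))\<^sup>2 = (norm (x - y))\<^sup>2 - 2 * ((x - y) \<bullet> z) + (norm z)\<^sup>2"
    by (simp_all add: power2_norm_eq_inner inner_simps inner_commute algebra_simps)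
  have "rpow c y p (x + z) \<le> ?A powr p + p * ?A powr (p - 1) * (c + (norm (x + z - y))\<^sup>2 - ?A)"
    "rpow c y p (x - z) \<le> ?A powr p + p * ?A powr (p - 1) * (c + (norm (x - z - y))\<^sup>2 - ?A)"
    unfolding rpow_def using assms by (intro powr_le_tangent; simp)+
  then show ?thesis
    unfolding rpow_def e by (simp add: algebra_simps)
qed

lemma C2_on_rpow:
  fixes y :: "'a::euclidean_space"
  assumes "\<And>x. x \<in> S \<Longrightarrow> 0 < c + (norm (x - y))\<^sup>2"
  shows "C2_on S (rpow c y p)"
proof -
  define w where "w x = c + (norm (x - y))\<^sup>2" for x
  define G where "G x = (2 * p * w x powr (p - 1)) *\<^sub>R (x - y)" for x
  \<comment> \<open>The Hessian: a multiple of the identity plus a rank-one map in the direction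
    \<open>x - y\<close>.\<close>
  define D where "D x = (2 * p * w x powr (p - 1)) *\<^sub>R (id_blinfun :: 'a \<Rightarrow>\<^sub>L 'a)
     + (4 * p * (p - 1) * w x powr (p - 2)) *\<^sub>R (blinfun_scaleR_left (x - y) o\<^sub>L blinfun_inner_left (x - y))" for x
  have w: "w x > 0" if "x \<in> S" for x using assms that by (simp add: w_def)
  have dw: "(w has_derivative (\<lambda>h. 2 * ((x - y) \<bullet> h))) (at x)" for x
    unfolding w_def power2_norm_eq_inner
    by (auto intro!: derivative_eq_intros simp: inner_commute)
  have dp: "((\<lambda>x. w x powr q) has_derivative (\<lambda>h. q * w x powr (q - 1) * (2 * ((x - y) \<bullet> h)))) (at x)"
    if "x \<in> S" for x q
  proof -
    have "((\<lambda>t. t powr q) has_real_derivative q * w x powr (q - 1)) (at (w x))"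
      using w[OF that] by (auto intro!: derivative_eq_intros)
    then have "((\<lambda>t. t powr q) has_derivative (\<lambda>h. q * w x powr (q - 1) * h)) (at (w x))"
      by (simp add: has_field_derivative_def)
    from has_derivative_compose[OF dw this] show ?thesis .
  qed
  have "GDERIV (rpow c y p) x :> G x" if "x \<in> S" for x
  proof -
    have "rpow c y p = (\<lambda>x. w x powr p)" by (simp add: rpow_def w_def fun_eq_iff)
    then show ?thesis
      unfolding gderiv_def using dp[OF that, of p]
      by (auto simp: G_def inner_commute algebra_simps elim!: has_derivative_eq_rhs)
  qed
  moreover have "(G has_derivative blinfun_apply (D x)) (at x)" if "x \<in> S" for x
  proof -
    have "(G has_derivative (\<lambda>h. (2 * p * w x powr (p - 1)) *\<^sub>R h +
        (2 * p * ((p - 1) * w x powr (p - 1 - 1) * (2 * ((x - y) \<bullet> h)))) *\<^sub>R (x - y))) (at x)"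
      unfolding G_def
      by (rule derivative_eq_intros dp[OF that] refl | simp)+
    then show ?thesis
      by (rule has_derivative_eq_rhs)
        (simp add: fun_eq_iff D_def blinfun.bilinear_simps blinfun.add_left blinfun.scaleR_left inner_commute algebra_simps)
  qed
  moreover have "continuous_on S D"
    unfolding D_def w_def using assms
    by (intro continuous_intros bounded_linear.continuous_on[OF bounded_linear_blinfun_scaleR_left]
        bounded_linear.continuous_on[OF bounded_linear_blinfun_inner_left] bounded_bilinear.continuous_on[OF bounded_bilinear_blinfun_compose])
      (force simp: less_le)+
  ultimately show ?thesis unfolding C2_on_def by blast
qed

lemma C2_on_linear_combination:
  assumes "C2_on S f" "C2_on S g"
  shows "C2_on S (\<lambda>x. k + a * f x + b * g x)"
proof -
  obtain G D where 1: "\<And>x. x \<in> S \<Longrightarrow> GDERIV f x :> G x" "\<And>x. x \<in> S \<Longrightarrow> (G has_derivative blinfun_apply (D x)) (at x)" "continuous_on S D"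
    using assms(1) unfolding C2_on_def by blast
  obtain G' D' where 2: "\<And>x. x \<in> S \<Longrightarrow> GDERIV g x :> G' x" "\<And>x. x \<in> S \<Longrightarrow> (G' has_derivative blinfun_apply (D' x)) (at x)" "continuous_on S D'"
    using assms(2) unfolding C2_on_def by blast
  have "GDERIV (\<lambda>x. k + a * f x + b * g x) x :> a *\<^sub>R G x + b *\<^sub>R G' x" if "x \<in> S" for x
    using 1(1)[OF that] 2(1)[OF that] unfolding gderiv_def
    by (auto intro!: derivative_eq_intros simp: inner_simps)
  moreover have "((\<lambda>x. a *\<^sub>R G x + b *\<^sub>R G' x) has_derivative blinfun_apply (a *\<^sub>R D x + b *\<^sub>R D' x)) (at x)" if "x \<in> S" for x
    using 1(2)[OF that] 2(2)[OF that]
    by (auto intro!: derivative_eq_intros simp: blinfun.bilinear_simps)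
  moreover have "continuous_on S (\<lambda>x. a *\<^sub>R D x + b *\<^sub>R D' x)"
    by (intro continuous_intros 1 2)
  ultimately show ?thesis unfolding C2_on_def
    by (intro exI[of _ "\<lambda>x. a *\<^sub>R G x + b *\<^sub>R G' x"] exI[of _ "\<lambda>x. a *\<^sub>R D x + b *\<^sub>R D' x"]) simp
qed

section \<open>Gradients and pointwise second-order expansions\<close>

lemma GDERIV_unique:
  assumes "GDERIV f x :> p" "GDERIV f x :> q"
  shows "p = q"
proof -
  have "(\<lambda>h. h \<bullet> p) = (\<lambda>h. h \<bullet> q)"
    using assms unfolding gderiv_def by (rule has_derivative_unique)
  then have "(p - q) \<bullet> p = (p - q) \<bullet> q" by (simp add: fun_eq_iff)
  then have "(p - q) \<bullet> (p - q) = 0" by (simp add: inner_diff_right)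
  then show ?thesis by simp
qed

lemma grad_eq: "GDERIV u x :> p \<Longrightarrow> grad u x = p"
  unfolding grad_def by (blast intro: GDERIV_unique)

text \<open>A quadratic error is of smaller order than \<open>norm z\<close>, so the vector in a
  \<open>C11_at\<close> expansion is the gradient that enters \<open>L_op\<close>.\<close>

lemma quadratic_expansion_GDERIV:
  assumes "r > 0" "\<And>z. norm z < r \<Longrightarrow> \<bar>u (x + z) - u x - p \<bullet> z\<bar> \<le> M * (norm z)\<^sup>2"
  shows "GDERIV u x :> p"
proof -
  have "((\<lambda>z. norm (u (x + z) - u x - z \<bullet> p) / norm z) \<longlongrightarrow> 0) (at 0)"
  proof (rule Lim_null_comparison)
    show "((\<lambda>z::'a. \<bar>M\<bar> * norm z) \<longlongrightarrow> 0) (at 0)" by (auto intro!: tendsto_eq_intros)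
    have "norm (norm (u (x + z) - u x - z \<bullet> p) / norm z) \<le> \<bar>M\<bar> * norm z" if "norm z < r" for z
    proof (cases "z = 0")
      case False
      have "\<bar>u (x + z) - u x - z \<bullet> p\<bar> \<le> \<bar>M\<bar> * (norm z)\<^sup>2"
        using assms(2)[OF that] mult_right_mono[OF abs_ge_self[of M] zero_le_power2[of "norm z"]]
        by (simp add: inner_commute)
      then show ?thesis using False by (simp add: field_simps power2_eq_square)
    qed simp
    then show "\<forall>\<^sub>F z in at 0. norm (norm (u (x + z) - u x - z \<bullet> p) / norm z) \<le> \<bar>M\<bar> * norm z"
      unfolding eventually_at using assms(1) by (intro exI[of _ r]) auto
  qed
  then show ?thesis
    unfolding gderiv_def has_derivative_at by (auto intro: bounded_linear_inner_left)
qed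

text \<open>Differentiability of the gradient at \<open>x\<close>, taken with tolerance 1, bounds
  its increments from \<open>x\<close> linearly; the mean value theorem along the segment from
  \<open>x\<close> to \<open>x + z\<close> turns this into a quadratic error.\<close>

lemma C11_at_if_C2_on:
  assumes "C2_on (ball x r) \<phi>" "r > 0"
  shows "\<phi> \<in> C11_at x"
proof -
  obtain G D where 1: "\<And>y. y \<in> ball x r \<Longrightarrow> GDERIV \<phi> y :> G y" "\<And>y. y \<in> ball x r \<Longrightarrow> (G has_derivative blinfun_apply (D y)) (at y)"
    using assms(1) unfolding C2_on_def by blast
  have "(G has_derivative blinfun_apply (D x)) (at x)" using 1(2) assms(2) by simp
  then have "\<exists>d>0. \<forall>y. norm (y - x) < d \<longrightarrow> norm (G y - G x - D x (y - x)) \<le> 1 * norm (y - x)"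
    unfolding has_derivative_at_alt using zero_less_one by blast
  then obtain d where d: "d > 0" "\<And>y. norm (y - x) < d \<Longrightarrow> norm (G y - G x - D x (y - x)) \<le> norm (y - x)"
    by auto
  define M where "M = 1 + norm (D x)"
  have GL: "norm (G y - G x) \<le> M * norm (y - x)" if "norm (y - x) < d" for y
    using d(2)[OF that] norm_blinfun[of "D x" "y - x"] norm_triangle_sub[of "G y - G x" "D x (y - x)"]
    by (simp add: M_def algebra_simps)
  have "\<bar>\<phi> (x + z) - \<phi> x - G x \<bullet> z\<bar> \<le> M * (norm z)\<^sup>2" if z: "norm z < min r d" for z
  proof -
    have seg: "x + t *\<^sub>R z \<in> ball x r" "norm (x + t *\<^sub>R z - x) < d" if "0 \<le> t" "t \<le> 1" for t
    proof -
      have "norm (t *\<^sub>R z) \<le> norm z" using that by (simp add: mult_left_le_one_le)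
      then show "x + t *\<^sub>R z \<in> ball x r" "norm (x + t *\<^sub>R z - x) < d" using z by (auto simp: dist_norm)
    qed
    have der: "((\<lambda>t. \<phi> (x + t *\<^sub>R z)) has_real_derivative G (x + t *\<^sub>R z) \<bullet> z) (at t)" if "0 \<le> t" "t \<le> 1" for t
    proof -
      have "((\<lambda>t. x + t *\<^sub>R z) has_derivative (\<lambda>h. h *\<^sub>R z)) (at t)"
        by (auto intro!: derivative_eq_intros)
      from has_derivative_compose[OF this, of \<phi>] 1(1)[OF seg(1)[OF that]]
      have "((\<lambda>t. \<phi> (x + t *\<^sub>R z)) has_derivative (\<lambda>h. (h *\<^sub>R z) \<bullet> G (x + t *\<^sub>R z))) (at t)"
        unfolding gderiv_def by blast
      then show ?thesis unfolding has_field_derivative_def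
        by (rule has_derivative_eq_rhs) (auto simp: inner_commute mult.commute)
    qed
    obtain t where t: "0 < t" "t < 1" "\<phi> (x + 1 *\<^sub>R z) - \<phi> (x + 0 *\<^sub>R z) = (1 - 0) * (G (x + t *\<^sub>R z) \<bullet> z)"
      using MVT2[of 0 1 "\<lambda>t. \<phi> (x + t *\<^sub>R z)" "\<lambda>t. G (x + t *\<^sub>R z) \<bullet> z"] der by force
    have M0: "M \<ge> 0" by (simp add: M_def)
    have "\<bar>\<phi> (x + z) - \<phi> x - G x \<bullet> z\<bar> = \<bar>(G (x + t *\<^sub>R z) - G x) \<bullet> z\<bar>"
      using t(3) by (simp add: inner_diff_left)
    also have "\<dots> \<le> norm (G (x + t *\<^sub>R z) - G x) * norm z" by (rule Cauchy_Schwarz_ineq2)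
    also have "\<dots> \<le> (M * norm (x + t *\<^sub>R z - x)) * norm z"
      using GL[OF seg(2)[of t]] t(1,2) by (intro mult_right_mono) simp_all
    also have "\<dots> = t * (M * (norm z)\<^sup>2)" using t by (simp add: power2_eq_square)
    also have "\<dots> \<le> M * (norm z)\<^sup>2" using t M0 by (intro mult_left_le_one_le) auto
    finally show ?thesis .
  qed
  then show ?thesis unfolding C11_at_def using assms(2) d(1)
    by (intro CollectI exI[of _ "G x"] exI[of _ M] exI[of _ "min r d"]) auto
qed

subsection \<open>The linear operators as integrals of second differences\<close>

lemma omega_pos: "0 < omega s z"
proof -
  have "0 < 1 + norm z" by (simp add: add_pos_nonneg)
  then show ?thesis unfolding omega_def by simp
qed

lemma omega_le_one: "0 \<le> s \<Longrightarrow> omega s z \<le> 1"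
  unfolding omega_def using powr_mono2'[of "- real DIM('a) - 2 * s" 1 "1 + norm z"] by simp

lemma omega_measurable [measurable]: "omega s \<in> borel_measurable (lebesgue :: 'a::euclidean_space measure)"
  by (rule borel_measurable_lebesgue) (unfold omega_def, measurable)

text \<open>From \<open>1 + norm (x + z) \<le> (1 + norm x) * (1 + norm z)\<close>: a translation
  changes the weight at most by a factor depending on \<open>x\<close>, which makes
  \<open>L1_omega\<close> translation invariant.\<close>

lemma omega_shift_le:
  fixes x z :: "'a::euclidean_space"
  assumes "0 \<le> s"
  shows "omega s z \<le> (1 + norm x) powr (real DIM('a) + 2 * s) * omega s (x + z)"
proof -
  let ?m = "real DIM('a) + 2 * s"
  have p: "0 < 1 + norm z" "0 < 1 + norm x" "0 < 1 + norm (x + z)"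
    by (simp_all add: add_pos_nonneg)
  have "1 + norm (x + z) \<le> (1 + norm x) * (1 + norm z)"
    using norm_triangle_ineq[of x z] mult_nonneg_nonneg[of "norm x" "norm z"]
    by (simp add: algebra_simps del: mult_nonneg_nonneg)
  then have "(1 + norm (x + z)) powr ?m \<le> ((1 + norm x) * (1 + norm z)) powr ?m"
    using assms p by (intro powr_mono2) auto
  then have "(1 + norm (x + z)) powr ?m \<le> (1 + norm x) powr ?m * (1 + norm z) powr ?m"
    using p by (simp add: powr_mult)
  then have "1 / (1 + norm z) powr ?m \<le> (1 + norm x) powr ?m * (1 / (1 + norm (x + z)) powr ?m)"
    using p by (simp add: divide_simps mult.commute)
  moreover have "omega s y = 1 / (1 + norm y) powr ?m" for y :: 'a
    unfolding omega_def by (simp add: powr_minus_divide[symmetric])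
  ultimately show ?thesis by simp
qed

lemma L1_omega_shift:
  fixes v :: "'a::euclidean_space \<Rightarrow> real"
  assumes "v \<in> L1_omega s" "0 \<le> s"
  shows "(\<lambda>z. v (x + z)) \<in> L1_omega s"
proof -
  have vm [measurable]: "v \<in> borel_measurable lebesgue" and vi: "integrable lebesgue (\<lambda>z. v z * omega s z)"
    using assms by (auto simp: L1_omega_def)
  have m [measurable]: "(\<lambda>z. v (x + z)) \<in> borel_measurable lebesgue"
    using measurable_compose[OF lebesgue_shift_measurable vm] .
  let ?C = "(1 + norm x) powr (real DIM('a) + 2 * s)"
  have "integrable lebesgue (\<lambda>z. ?C * (v (x + z) * omega s (x + z)))"
    using lebesgue_integrable_shift[OF vi, of x] by simp
  then have "integrable lebesgue (\<lambda>z. v (x + z) * omega s z)"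
  proof (rule Bochner_Integration.integrable_bound)
    show "AE z in lebesgue. norm (v (x + z) * omega s z) \<le> norm (?C * (v (x + z) * omega s (x + z)))"
    proof (rule AE_I2)
      fix z :: 'a
      have "\<bar>v (x + z)\<bar> * omega s z \<le> \<bar>v (x + z)\<bar> * (?C * omega s (x + z))"
        using omega_shift_le[OF assms(2), of z x] by (intro mult_left_mono) auto
      then show "norm (v (x + z) * omega s z) \<le> norm (?C * (v (x + z) * omega s (x + z)))"
        using omega_pos[of s z] omega_pos[of s "x + z"] by (simp add: abs_mult algebra_simps)
    qed
  qed measurable
  then show ?thesis using m by (simp add: L1_omega_def)
qed

lemma C11_at_shift: "v \<in> C11_at (x + h) \<Longrightarrow> (\<lambda>y. v (h + y)) \<in> C11_at x"
  unfolding C11_at_def by (auto simp: add_ac)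

text \<open>Global continuity bounds \<open>\<phi>\<close> on the closed ball, which excludes a
  blow-up at the gluing sphere; elsewhere the integrand is that of \<open>u\<close>.\<close>

lemma glue_in_L1_omega:
  fixes u \<phi> :: "'a::euclidean_space \<Rightarrow> real"
  assumes u: "u \<in> L1_omega s" and \<phi>: "continuous_on UNIV \<phi>" and s: "0 \<le> s"
  shows "glue x0 r \<phi> u \<in> L1_omega s"
proof -
  have um [measurable]: "u \<in> borel_measurable lebesgue" and ui: "integrable lebesgue (\<lambda>z. u z * omega s z)"
    using u by (auto simp: L1_omega_def)
  have [measurable]: "\<phi> \<in> borel_measurable lebesgue"
    using \<phi> by (intro borel_measurable_lebesgue borel_measurable_continuous_onI)
  have [measurable]: "ball x0 r \<in> sets lebesgue" by simp
  have gm: "glue x0 r \<phi> u \<in> borel_measurable lebesgue"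
    unfolding glue_def by measurable
  have "compact (\<phi> ` cball x0 r)"
    using \<phi> by (intro compact_continuous_image continuous_on_subset[OF \<phi>]) auto
  then obtain B where B: "\<And>x. x \<in> cball x0 r \<Longrightarrow> \<bar>\<phi> x\<bar> \<le> B"
    using compact_imp_bounded[of "\<phi> ` cball x0 r"] unfolding bounded_iff by (auto simp del: mem_cball)
  have ib: "integrable lebesgue (\<lambda>z. B * indicator (ball x0 r) z)"
    using emeasure_bounded_finite[of "ball x0 r"]
    by (intro integrable_mult_right integrable_real_indicator) auto
  have "integrable lebesgue (\<lambda>z. norm (u z * omega s z) + B * indicator (ball x0 r) z)"
    using ui ib by (intro Bochner_Integration.integrable_add integrable_norm) auto
  then have "integrable lebesgue (\<lambda>z. glue x0 r \<phi> u z * omega s z)"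
  proof (rule Bochner_Integration.integrable_bound)
    show "AE z in lebesgue. norm (glue x0 r \<phi> u z * omega s z) \<le> norm (norm (u z * omega s z) + B * indicator (ball x0 r) z)"
    proof (rule AE_I2)
      fix z :: 'a
      show "norm (glue x0 r \<phi> u z * omega s z) \<le> norm (norm (u z * omega s z) + B * indicator (ball x0 r) z)"
      proof (cases "z \<in> ball x0 r")
        case True
        then have b: "\<bar>\<phi> z\<bar> \<le> B" using B[of z] by auto
        have "\<bar>\<phi> z\<bar> * omega s z \<le> \<bar>\<phi> z\<bar> * 1"
          using omega_le_one[OF s] by (intro mult_left_mono) auto
        then have "\<bar>\<phi> z\<bar> * omega s z \<le> B + \<bar>u z\<bar> * omega s z" 
          using b mult_nonneg_nonneg[of "\<bar>u z\<bar>" "omega s z"] omega_pos[of s z] by linarith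
        then show ?thesis using True omega_pos[of s z] by (simp add: glue_def abs_mult)
      qed (simp add: glue_def)
    qed
  qed (use gm in measurable)
  then show ?thesis using gm by (simp add: L1_omega_def)
qed

lemma glue_in_C11_at:
  assumes "\<phi> \<in> C11_at x0" "r > 0"
  shows "glue x0 r \<phi> u \<in> C11_at x0"
proof -
  obtain p M d where d: "d > 0" "\<And>z. norm z < d \<Longrightarrow> \<bar>\<phi> (x0 + z) - \<phi> x0 - p \<bullet> z\<bar> \<le> M * (norm z)\<^sup>2"
    using assms(1) unfolding C11_at_def by blast
  then have "\<bar>glue x0 r \<phi> u (x0 + z) - glue x0 r \<phi> u x0 - p \<bullet> z\<bar> \<le> M * (norm z)\<^sup>2" if "norm z < min d r" for z
    using that assms(2) by (simp add: glue_def dist_norm)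
  then show ?thesis unfolding C11_at_def using d(1) assms(2)
    by (intro CollectI exI[of _ p] exI[of _ M] exI[of _ "min d r"]) auto
qed

text \<open>The kernel is controlled only away from the origin; a factor vanishing at 0 erases its
  arbitrary value there.\<close>

lemma kernel_measurable:
  fixes K :: "'a::euclidean_space \<Rightarrow> real"
  assumes "K \<in> K_sym s l L" "g \<in> borel_measurable lebesgue" "g 0 = 0"
  shows "(\<lambda>z. g z * K z) \<in> borel_measurable lebesgue"
proof -
  have "K \<in> borel_measurable (restrict_space lebesgue (- {0}))"
    using assms(1) by (simp add: K_sym_def)
  then have "(\<lambda>z. indicator (- {0}) z *\<^sub>R K z) \<in> borel_measurable lebesgue"
    by (subst (asm) borel_measurable_restrict_space_iff) auto
  then have "(\<lambda>z. g z * (indicator (- {0}) z *\<^sub>R K z)) \<in> borel_measurable lebesgue"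
    using assms(2) by measurable
  moreover have "(\<lambda>z. g z * (indicator (- {0}) z *\<^sub>R K z)) = (\<lambda>z. g z * K z)"
  proof
    show "g z * (indicator (- {0}) z *\<^sub>R K z) = g z * K z" for z
      using assms(3) by (cases "z = 0") auto
  qed
  ultimately show ?thesis by (simp only:)
qed

lemma kernel_bounds:
  fixes K :: "'a::euclidean_space \<Rightarrow> real"
  assumes "K \<in> K_sym s l L" "z \<noteq> 0"
  shows "0 \<le> K z" "l / norm z powr (real DIM('a) + 2 * s) \<le> K z"
    "K z \<le> L / norm z powr (real DIM('a) + 2 * s)" "K (- z) = K z"
proof -
  have "\<forall>z. z \<noteq> 0 \<longrightarrow> 0 \<le> K z \<and> l / norm z powr (real DIM('a) + 2 * s) \<le> K z \<and>
      K z \<le> L / norm z powr (real DIM('a) + 2 * s) \<and> K z = K (- z)"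
    using assms(1) unfolding K_sym_def by (elim CollectE conjE)
  then show "0 \<le> K z" "l / norm z powr (real DIM('a) + 2 * s) \<le> K z"
    "K z \<le> L / norm z powr (real DIM('a) + 2 * s)" "K (- z) = K z"
    using assms(2) by metis+
qed

text \<open>Needed to pass from a bound for every kernel to a bound for the supremum in
  \<open>elliptic_op\<close>. The witness is the smallest admissible kernel.\<close>

lemma K_sym_nonempty:
  assumes "0 < l" "l \<le> L"
  shows "K_sym s l L \<noteq> ({} :: ('a::euclidean_space \<Rightarrow> real) set)"
proof -
  have "(\<lambda>z::'a. l / norm z powr (real DIM('a) + 2 * s)) \<in> borel_measurable (lebesgue_on (- {0}))"
    by (intro measurable_restrict_space1 borel_measurable_lebesgue) measurable
  then have "(\<lambda>z::'a. l / norm z powr (real DIM('a) + 2 * s)) \<in> K_sym s l L"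
    unfolding K_sym_def using assms by (intro CollectI conjI allI impI divide_right_mono) simp_all
  then show ?thesis by blast
qed

text \<open>Near 0 the integrand is dominated by \<open>norm z powr a\<close> times the kernel
  bound, with \<open>a > 2 * s\<close>. Far away the translate of \<open>v\<close> is paid for by
  the weight \<open>omega\<close>, while \<open>v x\<close> and the gradient term are paid for by
  the integrable tail of the kernel.\<close>

lemma L_op_integrable:
  fixes v :: "'a::euclidean_space \<Rightarrow> real"
  assumes K: "K \<in> K_sym s l L" and v: "v \<in> C11_at x" "v \<in> L1_omega s" and s: "0 < s" "s < 1"
  shows "integrable lebesgue (\<lambda>z. (v (x + z) - v x
        - indicator {1..<2} (2 * s) * indicator (ball 0 1) z * (grad v x \<bullet> z)) * K z)"
proof -
  define m where "m = real DIM('a) + 2 * s"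
  obtain p M r0 where r0: "r0 > 0" "\<And>z. norm z < r0 \<Longrightarrow> \<bar>v (x + z) - v x - p \<bullet> z\<bar> \<le> M * (norm z)\<^sup>2"
    using v(1) unfolding C11_at_def by blast
  have g: "grad v x = p" by (rule grad_eq[OF quadratic_expansion_GDERIV[OF r0]])
  \<comment> \<open>Radius at most 1 places the near region inside the unit ball of the gradient
    correction and makes squares smaller than first powers.\<close>
  define r where "r = min r0 1"
  have r: "0 < r" "r \<le> 1" using r0 by (auto simp: r_def)
  \<comment> \<open>Order of vanishing at 0: quadratic when the gradient is subtracted, linear when
    it is not; in each range of \<open>s\<close> it exceeds \<open>2 * s\<close>.\<close>
  define a :: real where "a = (if s \<ge> 1/2 then 2 else 1)"
  have a: "0 \<le> a" "real DIM('a) + a - m > 0" using s by (auto simp: a_def m_def)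
  have m: "0 \<le> m" "real DIM('a) + 0 - m < 0" using s by (auto simp: m_def)
  \<comment> \<open>Read off from the kernel at a unit vector, where the upper bound is
    \<open>L\<close> itself.\<close>
  have L: "0 \<le> L"
  proof -
    obtain b :: 'a where b: "b \<in> Basis" using nonempty_Basis by blast
    then have "norm b = 1" "b \<noteq> 0" by auto
    then show ?thesis using kernel_bounds[OF K, of b] by simp
  qed
  define D where "D z = v (x + z) - v x
        - indicator {1..<2} (2 * s) * indicator (ball 0 1) z * (p \<bullet> z)" for z
  have vs: "(\<lambda>z. v (x + z)) \<in> L1_omega s" using L1_omega_shift[OF v(2)] s by simp
  have [measurable]: "(\<lambda>z. v (x + z)) \<in> borel_measurable lebesgue" using vs by (simp add: L1_omega_def)
  have [measurable]: "(\<lambda>z. p \<bullet> z) \<in> borel_measurable lebesgue" by (intro borel_measurable_lebesgue) measurable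
  have [measurable]: "ball (0::'a) 1 \<in> sets lebesgue" by simp
  have Dm: "D \<in> borel_measurable lebesgue" unfolding D_def by measurable
  define N where "N z = norm z powr a / norm z powr m * indicator (ball 0 r) z" for z :: 'a
  define F where "F z = norm z powr 0 / norm z powr m * indicator (- ball 0 r) z" for z :: 'a
  define C1 where "C1 = (norm p + \<bar>M\<bar>) * L"
  define C2 where "C2 = (1 + 1 / r) powr m * L"
  define C3 where "C3 = (\<bar>v x\<bar> + norm p) * L"
  have C: "0 \<le> C1" "0 \<le> C2" "0 \<le> C3" using L by (auto simp: C1_def C2_def C3_def)
  have NF: "0 \<le> N z" "0 \<le> F z" for z by (auto simp: N_def F_def)
  have iN: "integrable lebesgue N" 
    using integral_near_origin[OF a(1) m(1) a(2)] r(1) unfolding N_def by blast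
  have iF: "integrable lebesgue F" 
    using integral_far_from_origin[OF order_refl m(1) m(2)] r(1) unfolding F_def by blast
  have bound: "\<bar>D z * K z\<bar> \<le> C1 * N z + C2 * \<bar>v (x + z) * omega s z\<bar> + C3 * F z" for z
  proof (cases "z = 0")
    case True
    then show ?thesis using C NF[of 0] by (simp add: D_def)
  next
    case False
    then have nz: "norm z > 0" by simp
    note k = kernel_bounds[OF K False, folded m_def]
    have w: "0 \<le> C2 * \<bar>v (x + z) * omega s z\<bar>" using C by simp
    show ?thesis
    proof (cases "norm z < r")
      case True
      have e: "\<bar>v (x + z) - v x - p \<bullet> z\<bar> \<le> \<bar>M\<bar> * (norm z)\<^sup>2"
        using r0(2)[of z] True mult_right_mono[OF abs_ge_self[of M] zero_le_power2[of "norm z"]] by (simp add: r_def)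
      have "\<bar>D z\<bar> \<le> (norm p + \<bar>M\<bar>) * norm z powr a"
      proof (cases "s \<ge> 1/2")
        case s2: True
        then have "D z = v (x + z) - v x - p \<bullet> z" using s True r by (simp add: D_def)
        then have "\<bar>D z\<bar> \<le> (norm p + \<bar>M\<bar>) * (norm z)\<^sup>2" 
          using e mult_nonneg_nonneg[OF norm_ge_zero[of p] zero_le_power2[of "norm z"]]
          unfolding distrib_right by linarith
        then show ?thesis using s2 nz by (simp add: a_def)
      next
        case s2: False
        then have "D z = v (x + z) - v x" by (simp add: D_def)
        moreover have "\<bar>p \<bullet> z\<bar> \<le> norm p * norm z" by (rule Cauchy_Schwarz_ineq2)
        moreover have "\<bar>M\<bar> * (norm z)\<^sup>2 \<le> \<bar>M\<bar> * norm z"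
          using True r nz by (intro mult_left_mono) (auto simp: power2_eq_square mult_left_le)
        ultimately have "\<bar>D z\<bar> \<le> (norm p + \<bar>M\<bar>) * norm z" using e by (simp add: distrib_right)
        then show ?thesis using s2 nz by (simp add: a_def)
      qed
      then have "\<bar>D z\<bar> * K z \<le> ((norm p + \<bar>M\<bar>) * norm z powr a) * (L / norm z powr m)"
        using k by (intro mult_mono) auto
      also have "\<dots> = C1 * N z" using True by (simp add: C1_def N_def)
      finally have "\<bar>D z * K z\<bar> \<le> C1 * N z" using k by (simp add: abs_mult)
      then show ?thesis using w C NF[of z] mult_nonneg_nonneg[of C3 "F z"] by linarith
    next
      case far: False
      have "\<bar>indicator {1..<2} (2 * s) * indicator (ball 0 1) z * (p \<bullet> z)\<bar> \<le> norm p"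
      proof -
        have "\<bar>p \<bullet> z\<bar> \<le> norm p * norm z" by (rule Cauchy_Schwarz_ineq2)
        moreover have "norm p * norm z \<le> norm p" if "norm z < 1" using that by (intro mult_left_le) auto
        ultimately show ?thesis by (auto simp: indicator_def)
      qed
      then have "\<bar>D z\<bar> \<le> \<bar>v (x + z)\<bar> + (\<bar>v x\<bar> + norm p)" unfolding D_def by linarith
      then have "\<bar>D z\<bar> * K z \<le> (\<bar>v (x + z)\<bar> + (\<bar>v x\<bar> + norm p)) * (L / norm z powr m)"
        using k by (intro mult_mono) auto
      also have "\<dots> = \<bar>v (x + z)\<bar> * (1 / norm z powr m) * L + C3 * F z"
        using far nz by (simp add: C3_def F_def field_simps)
      \<comment> \<open>Outside the ball of radius \<open>r\<close>, \<open>1 + norm z\<close> is at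
        most \<open>(1 + 1 / r) * norm z\<close>, so the kernel is controlled by the weight.\<close>
      also have "1 / norm z powr m \<le> (1 + 1 / r) powr m * omega s z"
      proof -
        have "1 + norm z \<le> (1 + 1 / r) * norm z" using far r by (simp add: field_simps)
        then have "(1 + norm z) powr m \<le> ((1 + 1 / r) * norm z) powr m"
          using m by (intro powr_mono2) (auto intro: add_nonneg_nonneg)
        also have "\<dots> = (1 + 1 / r) powr m * norm z powr m"
          using r by (simp add: powr_mult)
        finally have "(1 + norm z) powr m \<le> (1 + 1 / r) powr m * norm z powr m" .
        moreover have "omega s z = 1 / (1 + norm z) powr m"
          unfolding omega_def m_def by (simp add: powr_minus_divide[symmetric])
        moreover have "1 / N \<le> Q * (1 / X)" if "X \<le> Q * N" "0 < X" "0 < N" for X Q N :: real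
          using that by (simp add: divide_simps mult.commute)
        moreover have "0 < (1 + norm z) powr m" "0 < norm z powr m"
          using nz add_pos_pos[OF zero_less_one nz] by simp_all
        ultimately show ?thesis by simp
      qed
      then have "\<bar>v (x + z)\<bar> * (1 / norm z powr m) * L \<le> \<bar>v (x + z)\<bar> * ((1 + 1 / r) powr m * omega s z) * L"
        using L by (intro mult_right_mono mult_left_mono) auto
      also have "\<dots> = C2 * \<bar>v (x + z) * omega s z\<bar>"
        using omega_pos[of s z] by (simp add: C2_def abs_mult)
      finally have "\<bar>D z * K z\<bar> \<le> C2 * \<bar>v (x + z) * omega s z\<bar> + C3 * F z"
        using k by (simp add: abs_mult)
      then show ?thesis using C NF[of z] mult_nonneg_nonneg[of C1 "N z"] by linarith
    qed
  qed
  have "integrable lebesgue (\<lambda>z. C1 * N z + C2 * \<bar>v (x + z) * omega s z\<bar> + C3 * F z)"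
    using vs iN iF by (auto simp: L1_omega_def)
  then have "integrable lebesgue (\<lambda>z. D z * K z)"
  proof (rule Bochner_Integration.integrable_bound)
    show "(\<lambda>z. D z * K z) \<in> borel_measurable lebesgue"
      by (rule kernel_measurable[OF K Dm]) (simp add: D_def)
    show "AE z in lebesgue. norm (D z * K z) \<le> norm (C1 * N z + C2 * \<bar>v (x + z) * omega s z\<bar> + C3 * F z)"
    proof (rule AE_I2)
      fix z
      show "norm (D z * K z) \<le> norm (C1 * N z + C2 * \<bar>v (x + z) * omega s z\<bar> + C3 * F z)"
        unfolding real_norm_def by (rule order_trans[OF bound abs_ge_self])
    qed
  qed
  then show ?thesis by (simp add: D_def g)
qed

text \<open>Add the integrand at \<open>z\<close> and at \<open>-z\<close>: the kernel is even and
  the gradient correction is odd, so it drops out. From here on the ranges of \<open>s\<close> need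
  no distinction and only values of \<open>v\<close> matter.\<close>

lemma L_op_second_difference:
  fixes v :: "'a::euclidean_space \<Rightarrow> real"
  assumes K: "K \<in> K_sym s l L" and v: "v \<in> C11_at x" "v \<in> L1_omega s" and s: "0 < s" "s < 1"
  shows "integrable lebesgue (\<lambda>z. (v (x + z) + v (x - z) - 2 * v x) * K z)"
    and "L_op s K v x = (LINT z|lebesgue. (v (x + z) + v (x - z) - 2 * v x) * K z) / 2"
proof -
  define D where "D z = (v (x + z) - v x
        - indicator {1..<2} (2 * s) * indicator (ball 0 1) z * (grad v x \<bullet> z)) * K z" for z
  have i: "integrable lebesgue D" unfolding D_def by (rule L_op_integrable[OF assms])
  note r = lebesgue_integral_reflect[OF i]
  have "D z + D (- z) = (v (x + z) + v (x - z) - 2 * v x) * K z" for z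
  proof (cases "z = 0")
    case False
    then show ?thesis using kernel_bounds(4)[OF K False]
      by (simp add: D_def algebra_simps indicator_def)
  qed (simp add: D_def)
  then have e: "(\<lambda>z. (v (x + z) + v (x - z) - 2 * v x) * K z) = (\<lambda>z. D z + D (- z))" by auto
  show "integrable lebesgue (\<lambda>z. (v (x + z) + v (x - z) - 2 * v x) * K z)"
    unfolding e using i r(1) by simp
  have "(LINT z|lebesgue. (v (x + z) + v (x - z) - 2 * v x) * K z) = 2 * (LINT z|lebesgue. D z)"
    unfolding e using i r by simp
  then show "L_op s K v x = (LINT z|lebesgue. (v (x + z) + v (x - z) - 2 * v x) * K z) / 2"
    unfolding L_op_def D_def by simp
qed

subsection \<open>Doubling of variables\<close>

text \<open>Arranged to equal \<open>u x\<close> at \<open>x\<close>. If \<open>(x, y)\<close>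
  maximises \<open>doubling\<close>, freezing \<open>y\<close> says exactly that this function
  touches \<open>u\<close> from above at \<open>x\<close>; freezing \<open>x\<close> gives the
  analogous statement for \<open>test_below\<close> from below at \<open>y\<close>.\<close>

definition test_above :: "('a::euclidean_space \<Rightarrow> real) \<Rightarrow> real \<Rightarrow> real \<Rightarrow> real \<Rightarrow> real \<Rightarrow> real \<Rightarrow> 'a \<Rightarrow> 'a \<Rightarrow> 'a \<Rightarrow> real" where
  "test_above u R T E \<alpha> \<sigma> x y = (\<lambda>\<xi>. (u x - E * rpow 0 y (\<alpha>/2) x - T * rpow (R\<^sup>2) 0 (\<sigma>/2) x)
      + E * rpow 0 y (\<alpha>/2) \<xi> + T * rpow (R\<^sup>2) 0 (\<sigma>/2) \<xi>)"

text \<open>The vanishing last summand of \<open>test_below\<close> gives both test functions the shape of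
  \<open>C2_on_linear_combination\<close>.\<close>

definition test_below :: "('a::euclidean_space \<Rightarrow> real) \<Rightarrow> real \<Rightarrow> real \<Rightarrow> 'a \<Rightarrow> 'a \<Rightarrow> 'a \<Rightarrow> real" where
  "test_below u E \<alpha> x y = (\<lambda>\<eta>. (u y + E * rpow 0 x (\<alpha>/2) y) + (- E) * rpow 0 x (\<alpha>/2) \<eta> + 0 * rpow 0 x (\<alpha>/2) \<eta>)"

text \<open>The penalty is not normalised by subtracting \<open>R powr \<sigma>\<close>; a positive
  maximum of the normalised function therefore appears as a value above
  \<open>- T * R powr \<sigma>\<close>.\<close>

definition doubling :: "('a::euclidean_space \<Rightarrow> real) \<Rightarrow> real \<Rightarrow> real \<Rightarrow> real \<Rightarrow> real \<Rightarrow> real \<Rightarrow> 'a \<Rightarrow> 'a \<Rightarrow> real" where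
  "doubling u R T E \<alpha> \<sigma> x y = u x - u y - E * norm (x - y) powr \<alpha> - T * rpow (R\<^sup>2) 0 (\<sigma>/2) x"

text \<open>Inside radius \<open>R\<close> the concave bound applies with a radicand of at least
  \<open>R^2\<close>. Outside, \<open>norm x \<le> R \<le> norm z\<close> bounds each radicand by
  \<open>5 * (norm z)^2\<close>, and two such terms give the factor 10. The shape matches the near
  and far radial integrals.\<close>

lemma penalty_second_difference:
  fixes x z :: "'a::euclidean_space"
  assumes "0 < R" "0 \<le> T" "0 < \<sigma>" "\<sigma> \<le> 2" "norm x \<le> R"
  shows "T * (rpow (R\<^sup>2) 0 (\<sigma>/2) (x + z) + rpow (R\<^sup>2) 0 (\<sigma>/2) (x - z) - 2 * rpow (R\<^sup>2) 0 (\<sigma>/2) x)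
      \<le> 2 * T * R powr (\<sigma> - 2) * norm z powr 2 * indicator (ball 0 R) z
        + 10 * T * norm z powr \<sigma> * indicator (- ball 0 R) z"
proof (cases "norm z < R")
  case True
  have "(R\<^sup>2 + (norm (x - 0))\<^sup>2) powr (\<sigma>/2 - 1) \<le> (R\<^sup>2) powr (\<sigma>/2 - 1)"
    using assms by (intro powr_mono2') auto
  also have "\<dots> = R powr (\<sigma> - 2)"
  proof -
    have "R\<^sup>2 = R powr 2" "2 * (\<sigma>/2 - 1) = \<sigma> - 2" using assms by simp_all
    then show ?thesis by (simp only: powr_powr)
  qed
  finally have le: "(R\<^sup>2 + (norm (x - 0))\<^sup>2) powr (\<sigma>/2 - 1) \<le> R powr (\<sigma> - 2)" .
  have "rpow (R\<^sup>2) 0 (\<sigma>/2) (x + z) + rpow (R\<^sup>2) 0 (\<sigma>/2) (x - z) - 2 * rpow (R\<^sup>2) 0 (\<sigma>/2) x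
      \<le> 2 * (\<sigma>/2) * (R\<^sup>2 + (norm (x - 0))\<^sup>2) powr (\<sigma>/2 - 1) * (norm z)\<^sup>2"
    using assms by (intro rpow_second_difference_le add_pos_nonneg) auto
  also have "\<dots> \<le> 2 * R powr (\<sigma> - 2) * (norm z)\<^sup>2"
    using le assms by (intro mult_right_mono mult_mono) auto
  finally show ?thesis
    using True assms(2) by (auto dest: mult_left_mono[of _ _ T] simp: mult_ac)
next
  case False
  have b: "rpow (R\<^sup>2) 0 (\<sigma>/2) (x + w) \<le> 5 * norm z powr \<sigma>" if "norm w = norm z" for w
  proof -
    have "norm (x + w) \<le> 2 * norm z"
      using norm_triangle_ineq[of x w] False assms(5) that by linarith
    then have "(norm (x + w))\<^sup>2 \<le> (2 * norm z)\<^sup>2" by (intro power_mono) auto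
    moreover have "R\<^sup>2 \<le> (norm z)\<^sup>2" using False assms by (intro power_mono) auto
    ultimately have "R\<^sup>2 + (norm (x + w - 0))\<^sup>2 \<le> 5 * (norm z)\<^sup>2" by (simp add: power_mult_distrib)
    then have "rpow (R\<^sup>2) 0 (\<sigma>/2) (x + w) \<le> (5 * (norm z)\<^sup>2) powr (\<sigma>/2)"
      unfolding rpow_def using assms by (intro powr_mono2) auto
    also have "\<dots> = 5 powr (\<sigma>/2) * norm z powr \<sigma>"
      by (simp add: powr_mult powr_powr flip: powr_numeral)
    also have "\<dots> \<le> 5 powr 1 * norm z powr \<sigma>"
      using assms by (intro mult_right_mono powr_mono) auto
    finally show ?thesis by simp
  qed
  have "rpow (R\<^sup>2) 0 (\<sigma>/2) (x + z) + rpow (R\<^sup>2) 0 (\<sigma>/2) (x - z) - 2 * rpow (R\<^sup>2) 0 (\<sigma>/2) x \<le> 10 * norm z powr \<sigma>"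
  proof -
    have "0 \<le> rpow (R\<^sup>2) 0 (\<sigma>/2) x" by (simp add: rpow_def)
    moreover have "rpow (R\<^sup>2) 0 (\<sigma>/2) (x - z) \<le> 5 * norm z powr \<sigma>" using b[of "- z"] by simp
    ultimately show ?thesis using b[of z] by linarith
  qed
  then show ?thesis
    using False assms(2) by (auto dest: mult_left_mono[of _ _ T] simp: mult_ac)
qed

text \<open>Coupling \<open>z\<close> with \<open>z\<close> cancels the modulus of continuity, and
  coupling \<open>z\<close> with \<open>-z\<close> near the direction \<open>x - y\<close> exploits its concavity.\<close>

lemma doubling_second_difference:
  fixes u :: "'a::euclidean_space \<Rightarrow> real"
  assumes max: "\<And>x' y'. doubling u R T E \<alpha> \<sigma> x' y' \<le> doubling u R T E \<alpha> \<sigma> x y"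
    and xy: "x \<noteq> y" and E: "0 < E" and \<alpha>: "0 < \<alpha>" "\<alpha> < 1"
    and \<rho>: "\<rho> < 1/8" "(3/2 + 2*\<rho>) powr \<alpha> + (1/2 + 2*\<rho>) powr \<alpha> \<le> 2 - c"
    and r: "0 < r" "r \<le> norm (x - y) / 8"
  defines "v \<equiv> glue x r (test_above u R T E \<alpha> \<sigma> x y) u"
    and "w \<equiv> glue y r (test_below u E \<alpha> x y) u"
  shows "(v (x + z) + v (x - z) - 2 * v x) - (w (y + z) + w (y - z) - 2 * w y)
     \<le> T * (rpow (R\<^sup>2) 0 (\<sigma>/2) (x + z) + rpow (R\<^sup>2) 0 (\<sigma>/2) (x - z) - 2 * rpow (R\<^sup>2) 0 (\<sigma>/2) x)
       + 2 * E * norm (x - y) powr (\<alpha> - 2) * norm z powr 2 * indicator (ball 0 r) z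
       - c * E * norm (x - y) powr \<alpha> * indicator (ball ((1/4) *\<^sub>R (x - y)) (\<rho> * norm (x - y))) z"
proof -
  define a where "a = x - y"
  define b where "b = norm a"
  have b: "b > 0" using xy by (simp add: a_def b_def)
  let ?\<psi> = "rpow (R\<^sup>2) 0 (\<sigma>/2)"
  let ?D = "T * (?\<psi> (x + z) + ?\<psi> (x - z) - 2 * ?\<psi> x)"
  have ctr: "v x = u x" "w y = u y"
    using r by (auto simp: v_def w_def glue_def test_above_def test_below_def)
  have m: "u x' - u y' \<le> u x - u y + E * norm (x' - y') powr \<alpha> - E * b powr \<alpha> + T * ?\<psi> x' - T * ?\<psi> x" for x' y'
    using max[of x' y'] by (simp add: doubling_def a_def b_def)
  show ?thesis
  proof (cases "norm z < r")
    case True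
    \<comment> \<open>The ball about \<open>a/4\<close> of radius below \<open>b/8\<close> stays
      outside the gluing radius, which is at most \<open>b/8\<close>.\<close>
    have zA: "z \<notin> ball ((1/4) *\<^sub>R a) (\<rho> * b)"
    proof
      assume "z \<in> ball ((1/4) *\<^sub>R a) (\<rho> * b)"
      then have "norm ((1/4) *\<^sub>R a - z) < \<rho> * b" by (simp add: dist_norm)
      moreover have "\<rho> * b \<le> 1/8 * b" using \<rho> b by (intro mult_right_mono) auto
      moreover have "b / 4 \<le> norm ((1/4) *\<^sub>R a - z) + norm z"
        using norm_triangle_sub[of "(1/4) *\<^sub>R a" z] by (simp add: b_def)
      ultimately show False using True r(2) by (simp add: b_def a_def)
    qed
    have vz: "v (x + z) = u x - E * b powr \<alpha> - T * ?\<psi> x + E * rpow 0 0 (\<alpha>/2) (a + z) + T * ?\<psi> (x + z)"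
      "v (x - z) = u x - E * b powr \<alpha> - T * ?\<psi> x + E * rpow 0 0 (\<alpha>/2) (a - z) + T * ?\<psi> (x - z)"
      using True by (auto simp: v_def glue_def test_above_def dist_norm rpow_zero a_def b_def algebra_simps)
    have nc: "norm (y + z - x) = norm (a - z)" "norm (y - z - x) = norm (a + z)" "norm (y - x) = b"
      by (simp_all add: a_def b_def norm_minus_commute algebra_simps)
    have wz: "w (y + z) = u y + E * b powr \<alpha> - E * rpow 0 0 (\<alpha>/2) (a - z)"
      "w (y - z) = u y + E * b powr \<alpha> - E * rpow 0 0 (\<alpha>/2) (a + z)"
      using True by (auto simp: w_def glue_def test_below_def dist_norm rpow_zero nc)
    have "rpow 0 0 (\<alpha>/2) (a + z) + rpow 0 0 (\<alpha>/2) (a - z) - 2 * rpow 0 0 (\<alpha>/2) a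
        \<le> 2 * (\<alpha>/2) * (0 + (norm (a - 0))\<^sup>2) powr (\<alpha>/2 - 1) * (norm z)\<^sup>2"
      using \<alpha> b by (intro rpow_second_difference_le) (auto simp: b_def)
    also have "(0 + (norm (a - 0))\<^sup>2) powr (\<alpha>/2 - 1) = b powr (\<alpha> - 2)"
    proof -
      have "0 + (norm (a - 0))\<^sup>2 = b powr 2" "2 * (\<alpha>/2 - 1) = \<alpha> - 2" using b by (simp_all add: b_def)
      then show ?thesis by (simp only: powr_powr)
    qed
    also have "2 * (\<alpha>/2) * b powr (\<alpha> - 2) * (norm z)\<^sup>2 \<le> 1 * b powr (\<alpha> - 2) * (norm z)\<^sup>2"
      using \<alpha> by (intro mult_right_mono) auto
    finally have q: "rpow 0 0 (\<alpha>/2) (a + z) + rpow 0 0 (\<alpha>/2) (a - z) - 2 * b powr \<alpha> \<le> b powr (\<alpha> - 2) * (norm z)\<^sup>2"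
      by (simp add: rpow_zero b_def)
    \<comment> \<open>Both test functions contribute the same second difference of the modulus at
      \<open>a\<close>, hence the factor 2.\<close>
    have "(v (x + z) + v (x - z) - 2 * v x) - (w (y + z) + w (y - z) - 2 * w y)
       = ?D + 2 * E * (rpow 0 0 (\<alpha>/2) (a + z) + rpow 0 0 (\<alpha>/2) (a - z) - 2 * b powr \<alpha>)"
      unfolding ctr vz wz by (simp add: algebra_simps)
    also have "\<dots> \<le> ?D + 2 * E * (b powr (\<alpha> - 2) * (norm z)\<^sup>2)"
      using q E by (intro add_left_mono mult_left_mono) auto
    finally show ?thesis
      using True zA unfolding a_def b_def by (simp add: mult_ac)
  next
    case False
    then have far: "v (x + z) = u (x + z)" "v (x - z) = u (x - z)" "w (y + z) = u (y + z)" "w (y - z) = u (y - z)"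
      by (auto simp: v_def w_def glue_def dist_norm)
    show ?thesis
    proof (cases "z \<in> ball ((1/4) *\<^sub>R a) (\<rho> * b)")
      case A: True
      then have zd: "norm (z - (1/4) *\<^sub>R a) \<le> \<rho> * b" by (simp add: dist_norm norm_minus_commute)
      \<comment> \<open>Moving \<open>x\<close> by \<open>z\<close> and \<open>y\<close> by
        \<open>-z\<close> changes \<open>a\<close> into \<open>a + 2z\<close>, the opposite move
        into \<open>a - 2z\<close>. Near \<open>z = a/4\<close> these are close to
        \<open>3a/2\<close> and \<open>a/2\<close>, the configuration of
        \<open>powr_midpoint_gap\<close>.\<close>
      have n1: "norm (a + 2 *\<^sub>R z) \<le> (3/2 + 2*\<rho>) * b"
      proof -
        have "a + 2 *\<^sub>R z = (3/2) *\<^sub>R a + 2 *\<^sub>R (z - (1/4) *\<^sub>R a)"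
          using scaleR_diff_left[of "3/2" "1/2" a] by (simp add: algebra_simps)
        then have "norm (a + 2 *\<^sub>R z) \<le> norm ((3/2) *\<^sub>R a) + norm (2 *\<^sub>R (z - (1/4) *\<^sub>R a))"
          by (metis norm_triangle_ineq)
        then show ?thesis using zd unfolding norm_scaleR distrib_right b_def[symmetric] by simp
      qed
      have n2: "norm (a - 2 *\<^sub>R z) \<le> (1/2 + 2*\<rho>) * b"
      proof -
        have "a - 2 *\<^sub>R z = (1/2) *\<^sub>R a - 2 *\<^sub>R (z - (1/4) *\<^sub>R a)"
          using scaleR_add_left[of "1/2" "1/2" a] by (simp add: algebra_simps)
        then have "norm (a - 2 *\<^sub>R z) \<le> norm ((1/2) *\<^sub>R a) + norm (2 *\<^sub>R (z - (1/4) *\<^sub>R a))"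
          by (metis norm_triangle_ineq4)
        then show ?thesis using zd unfolding norm_scaleR distrib_right b_def[symmetric] by simp
      qed
      have \<rho>0: "0 \<le> \<rho>" using order_trans[OF norm_ge_zero zd] b by (simp add: zero_le_mult_iff)
      have "norm (a + 2 *\<^sub>R z) powr \<alpha> + norm (a - 2 *\<^sub>R z) powr \<alpha>
          \<le> ((3/2 + 2*\<rho>) * b) powr \<alpha> + ((1/2 + 2*\<rho>) * b) powr \<alpha>"
        using n1 n2 \<alpha> by (intro add_mono powr_mono2) auto
      also have "\<dots> = ((3/2 + 2*\<rho>) powr \<alpha> + (1/2 + 2*\<rho>) powr \<alpha>) * b powr \<alpha>"
        by (simp only: powr_mult[of "3/2 + 2*\<rho>" b] powr_mult[of "1/2 + 2*\<rho>" b] distrib_right[of _ _ "b powr \<alpha>"])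
      also have "\<dots> \<le> (2 - c) * b powr \<alpha>" using \<rho> by (intro mult_right_mono) auto
      finally have "E * (norm (a + 2 *\<^sub>R z) powr \<alpha> + norm (a - 2 *\<^sub>R z) powr \<alpha>) \<le> E * ((2 - c) * b powr \<alpha>)"
        using E by (intro mult_left_mono) auto
      moreover have e: "x + z - (y - z) = a + 2 *\<^sub>R z" "x - z - (y + z) = a - 2 *\<^sub>R z"
        by (simp_all add: a_def scaleR_2)
      ultimately have "(u (x + z) + u (x - z) - 2 * u x) - (u (y + z) + u (y - z) - 2 * u y)
        \<le> ?D - c * E * b powr \<alpha>"
        using m[of "x + z" "y - z", unfolded e] m[of "x - z" "y + z", unfolded e] by (simp add: algebra_simps)
      then show ?thesis using A False unfolding ctr far by (simp add: a_def b_def)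
    next
      case A: False
      \<comment> \<open>Moving both points by the same vector leaves \<open>a\<close> unchanged, so
        only the penalty remains.\<close>
      have e: "x + z - (y + z) = a" "x - z - (y - z) = a" by (simp_all add: a_def)
      have "(u (x + z) + u (x - z) - 2 * u x) - (u (y + z) + u (y - z) - 2 * u y) \<le> ?D"
        using m[of "x + z" "y + z", unfolded e] m[of "x - z" "y - z", unfolded e] by (simp add: b_def algebra_simps)
      then show ?thesis using A False unfolding ctr far by (simp add: a_def b_def)
    qed
  qed
qed

text \<open>The pointwise bound is integrated against the kernel. The penalty costs
  \<open>R powr (\<sigma> - 2 * s)\<close>; the ball about \<open>(x - y)/4\<close> gains
  \<open>b powr (\<alpha> - 2 * s)\<close> with \<open>b = norm (x - y)\<close>. The error inside
  the gluing ball has the same order in \<open>b\<close> as the gain but carries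
  \<open>\<kappa> powr (2 - 2 * s)\<close>, so a small \<open>\<kappa>\<close> lets the gain
  win.\<close>

lemma L_op_doubling_estimate:
  fixes s l L \<alpha> \<sigma> :: real
  assumes s: "0 < s" "s < 1" and lL: "0 < l" "l \<le> L" and \<alpha>: "0 < \<alpha>" "\<alpha> < 1" and \<sigma>: "0 < \<sigma>" "\<sigma> < 2 * s"
  shows "\<exists>c C \<kappa>. 0 < c \<and> 0 \<le> C \<and> 0 < \<kappa> \<and> \<kappa> \<le> 1/8 \<and>
    (\<forall>(u :: 'a::euclidean_space \<Rightarrow> real) R T E x y K. 0 < R \<and> 0 \<le> T \<and> 0 < E \<and> x \<noteq> y \<and> norm x \<le> R \<and>
       (\<forall>x' y'. doubling u R T E \<alpha> \<sigma> x' y' \<le> doubling u R T E \<alpha> \<sigma> x y) \<and> K \<in> K_sym s l L \<and>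
       glue x (\<kappa> * norm (x - y)) (test_above u R T E \<alpha> \<sigma> x y) u \<in> C11_at x \<inter> L1_omega s \<and>
       glue y (\<kappa> * norm (x - y)) (test_below u E \<alpha> x y) u \<in> C11_at y \<inter> L1_omega s \<longrightarrow>
       L_op s K (glue x (\<kappa> * norm (x - y)) (test_above u R T E \<alpha> \<sigma> x y) u) x
        - L_op s K (glue y (\<kappa> * norm (x - y)) (test_below u E \<alpha> x y) u) y
       \<le> C * T * R powr (\<sigma> - 2 * s) - c * E * norm (x - y) powr (\<alpha> - 2 * s))"
proof -
  let ?n = "real DIM('a)"
  define m where "m = ?n + 2 * s"
  have m: "0 \<le> m" using s by (simp add: m_def)
  obtain \<rho> c0 where \<rho>: "0 < \<rho>" "\<rho> < 1/8" "0 < c0" "(3/2 + 2*\<rho>) powr \<alpha> + (1/2 + 2*\<rho>) powr \<alpha> \<le> 2 - c0"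
    using powr_midpoint_gap[OF \<alpha>] by blast
  have en: "?n + 2 - m = 2 - 2 * s" "?n + \<sigma> - m = \<sigma> - 2 * s" by (simp_all add: m_def)
  define N where "N R z = norm z powr 2 / norm z powr m * indicator (ball 0 R) z" for R and z :: 'a
  define F where "F R z = norm z powr \<sigma> / norm z powr m * indicator (- ball 0 R) z" for R and z :: 'a
  obtain cN where cN: "0 \<le> cN" "\<And>R. R > 0 \<Longrightarrow> integrable lebesgue (N R)"
      "\<And>R. R > 0 \<Longrightarrow> (LINT z|lebesgue. N R z) \<le> cN * R powr (2 - 2 * s)"
    using integral_near_origin[of 2 m, where 'a='a] s m unfolding en N_def by fastforce
  obtain cF where cF: "0 \<le> cF" "\<And>R. R > 0 \<Longrightarrow> integrable lebesgue (F R)"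
      "\<And>R. R > 0 \<Longrightarrow> (LINT z|lebesgue. F R z) \<le> cF * R powr (\<sigma> - 2 * s)"
    using integral_far_from_origin[of \<sigma> m, where 'a='a] \<sigma> m unfolding en F_def by fastforce
  \<comment> \<open>The integral over \<open>A\<close> gains four times \<open>c\<close>: the
    symmetrised operator halves it, and half of the rest is given up to the gluing error.\<close>
  define c where "c = c0 * l * (unit_ball_vol ?n * \<rho> powr ?n) / 4"
  have c: "c > 0" using \<rho> lL by (simp add: c_def)
  \<comment> \<open>Solves \<open>L * cN * \<kappa> powr (2 - 2 * s) \<le> c\<close>; the added 1
    keeps the denominator positive even if \<open>cN\<close> is 0, and the cap 1/8 separates the
    gluing ball from the ball of gain.\<close>
  define \<kappa> where "\<kappa> = min (1/8) ((c / (L * cN + 1)) powr (1 / (2 - 2 * s)))"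
  have L: "0 < L" using lL by simp
  have LN: "0 < L * cN + 1" using L cN(1) by (simp add: add_nonneg_pos)
  have \<kappa>: "0 < \<kappa>" "\<kappa> \<le> 1/8" using c LN by (auto simp: \<kappa>_def)
  have \<kappa>c: "L * cN * \<kappa> powr (2 - 2 * s) \<le> c"
  proof -
    have "\<kappa> powr (2 - 2 * s) \<le> ((c / (L * cN + 1)) powr (1 / (2 - 2 * s))) powr (2 - 2 * s)"
      using \<kappa> s by (intro powr_mono2) (auto simp: \<kappa>_def)
    also have "\<dots> = c / (L * cN + 1)"
      using s c LN by (simp add: powr_powr)
    finally have "L * cN * \<kappa> powr (2 - 2 * s) \<le> L * cN * (c / (L * cN + 1))"
      using L cN(1) by (intro mult_left_mono) auto
    also have "\<dots> = c * (L * cN / (L * cN + 1))" by simp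
    also have "\<dots> \<le> c * 1" using c LN by (intro mult_left_mono) auto
    finally show ?thesis by simp
  qed
  define C where "C = L * cN + 5 * L * cF"
  have C: "0 \<le> C" using L cN(1) cF(1) by (simp add: C_def)
  have main: "L_op s K (glue x (\<kappa> * norm (x - y)) (test_above u R T E \<alpha> \<sigma> x y) u) x
        - L_op s K (glue y (\<kappa> * norm (x - y)) (test_below u E \<alpha> x y) u) y
       \<le> C * T * R powr (\<sigma> - 2 * s) - c * E * norm (x - y) powr (\<alpha> - 2 * s)"
    if "0 < R" "0 \<le> T" "0 < E" "x \<noteq> y" "norm x \<le> R" 
      and max: "\<And>x' y'. doubling u R T E \<alpha> \<sigma> x' y' \<le> doubling u R T E \<alpha> \<sigma> x y" 
      and K: "K \<in> K_sym s l L"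
      and V: "glue x (\<kappa> * norm (x - y)) (test_above u R T E \<alpha> \<sigma> x y) u \<in> C11_at x"
        "glue x (\<kappa> * norm (x - y)) (test_above u R T E \<alpha> \<sigma> x y) u \<in> L1_omega s"
      and W: "glue y (\<kappa> * norm (x - y)) (test_below u E \<alpha> x y) u \<in> C11_at y"
        "glue y (\<kappa> * norm (x - y)) (test_below u E \<alpha> x y) u \<in> L1_omega s"
    for u :: "'a \<Rightarrow> real" and R T E x y K
  proof -
    define b where "b = norm (x - y)"
    have b: "b > 0" using that by (simp add: b_def)
    define r where "r = \<kappa> * b"
    have r: "0 < r" "r \<le> b / 8" using \<kappa> b by (auto simp: r_def)
    define v where "v = glue x r (test_above u R T E \<alpha> \<sigma> x y) u"
    define w where "w = glue y r (test_below u E \<alpha> x y) u"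
    define A where "A = ball ((1/4) *\<^sub>R (x - y)) (\<rho> * b)"
    define S where "S z = (v (x + z) + v (x - z) - 2 * v x) * K z - (w (y + z) + w (y - z) - 2 * w y) * K z" for z
    note Lv = L_op_second_difference[OF K V s, folded b_def, folded r_def, folded v_def]
    note Lw = L_op_second_difference[OF K W s, folded b_def, folded r_def, folded w_def]
    have iS: "integrable lebesgue S" unfolding S_def using Lv(1) Lw(1) by simp
    have LS: "L_op s K v x - L_op s K w y = (LINT z|lebesgue. S z) / 2"
      unfolding S_def Lv(2) Lw(2) using Lv(1) Lw(1) by (simp add: diff_divide_distrib)
    define k1 where "k1 = 2 * T * R powr (\<sigma> - 2) * L"
    define k2 where "k2 = 10 * T * L"
    define k3 where "k3 = 2 * E * b powr (\<alpha> - 2) * L"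
    define k4 where "k4 = c0 * E * b powr \<alpha> * (l / b powr m)"
    define G where "G z = k1 * N R z + k2 * F R z + k3 * N r z - k4 * indicator A z" for z
    \<comment> \<open>Positive contributions take the upper kernel bound and the gain takes the
      lower one. On \<open>A\<close> one has \<open>norm z \<le> b\<close>, so the kernel is at
      least \<open>l / b powr m\<close>. At \<open>z = 0\<close> the left side vanishes whatever the
      kernel is.\<close>
    have SG: "S z \<le> G z" for z
    proof (cases "z = 0")
      case True
      have "0 \<notin> A"
      proof
        assume "0 \<in> A"
        then have "b / 4 < \<rho> * b" by (simp add: A_def b_def)
        then show False using \<rho> b by simp
      qed
      then show ?thesis using True that(1) r(1) by (simp add: S_def G_def N_def F_def v_def w_def)
    next
      case False
      then have nz: "0 < norm z" by simp
      note k = kernel_bounds[OF K False, folded m_def]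
      define P1 where "P1 = 2 * T * R powr (\<sigma> - 2) * norm z powr 2 * indicator (ball 0 R) z"
      define P2 where "P2 = 10 * T * norm z powr \<sigma> * indicator (- ball 0 R) z"
      define P3 where "P3 = 2 * E * b powr (\<alpha> - 2) * norm z powr 2 * indicator (ball 0 r) z"
      define Q where "Q = c0 * E * b powr \<alpha> * indicator A z"
      have P0: "0 \<le> P1" "0 \<le> P2" "0 \<le> P3" "0 \<le> Q"
        using that(2,3) \<rho> by (simp_all add: P1_def P2_def P3_def Q_def)
      have "(v (x + z) + v (x - z) - 2 * v x) - (w (y + z) + w (y - z) - 2 * w y) \<le> P1 + P2 + P3 - Q"
        using doubling_second_difference[OF max that(4,3) \<alpha> \<rho>(2,4) r[unfolded b_def], of z]
          penalty_second_difference[OF that(1,2) \<sigma>(1) _ that(5), of z] s \<sigma>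
        unfolding v_def w_def P1_def P2_def P3_def Q_def A_def b_def by linarith
      then have "S z \<le> (P1 + P2 + P3 - Q) * K z"
        unfolding S_def left_diff_distrib[symmetric] using k(1) by (intro mult_right_mono)
      also have "\<dots> = (P1 + P2 + P3) * K z - Q * K z" by (simp add: algebra_simps)
      also have "(P1 + P2 + P3) * K z \<le> (P1 + P2 + P3) * (L / norm z powr m)"
        using P0 k(3) by (intro mult_left_mono) auto
      also have "(P1 + P2 + P3) * (L / norm z powr m) = k1 * N R z + k2 * F R z + k3 * N r z"
        by (simp add: P1_def P2_def P3_def k1_def k2_def k3_def N_def F_def algebra_simps)
      finally have "S z \<le> k1 * N R z + k2 * F R z + k3 * N r z - Q * K z" by simp
      moreover have "k4 * indicator A z \<le> Q * K z"
      proof (cases "z \<in> A")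
        case True
        have "norm z \<le> b"
        proof -
          have "norm ((1/4) *\<^sub>R (x - y) - z) < \<rho> * b" using True by (simp add: A_def dist_norm)
          moreover have "\<rho> * b \<le> 1/8 * b" using \<rho> b by (intro mult_right_mono) auto
          moreover have "norm z \<le> norm ((1/4) *\<^sub>R (x - y)) + norm ((1/4) *\<^sub>R (x - y) - z)"
            by (metis norm_triangle_sub norm_minus_commute)
          moreover have "norm ((1/4) *\<^sub>R (x - y)) = b / 4" by (simp add: b_def)
          ultimately show ?thesis using b by linarith
        qed
        then have "norm z powr m \<le> b powr m" using m by (intro powr_mono2) auto
        then have "l / b powr m \<le> l / norm z powr m" using lL nz b by (intro divide_left_mono) auto
        then have "l / b powr m \<le> K z" using k(2) by linarith
        then have "(c0 * E * b powr \<alpha>) * (l / b powr m) \<le> (c0 * E * b powr \<alpha>) * K z"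
          using \<rho> that by (intro mult_left_mono) auto
        then show ?thesis using True by (simp add: k4_def Q_def)
      qed (use P0 k in simp)
      ultimately show ?thesis unfolding G_def by linarith
    qed
    have A: "A \<in> sets lebesgue" "emeasure lebesgue A < \<infinity>"
      unfolding A_def using emeasure_bounded_finite[of "ball ((1/4) *\<^sub>R (x - y)) (\<rho> * b)"] by auto
    have iA: "integrable lebesgue (indicator A :: 'a \<Rightarrow> real)"
      using A by (intro integrable_real_indicator)
    have iG: "integrable lebesgue G"
      unfolding G_def using cN(2)[OF that(1)] cN(2)[OF r(1)] cF(2)[OF that(1)] iA
      by (intro Bochner_Integration.integrable_add Bochner_Integration.integrable_diff integrable_mult_right) auto
    have mA: "measure lebesgue A = unit_ball_vol ?n * \<rho> powr ?n * b powr ?n"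
      using \<rho> b unfolding A_def by (simp add: content_ball powr_realpow power_mult_distrib)
    have "(LINT z|lebesgue. S z) \<le> (LINT z|lebesgue. G z)"
      using iS iG SG by (intro integral_mono)
    also have "\<dots> = k1 * (LINT z|lebesgue. N R z) + k2 * (LINT z|lebesgue. F R z) + k3 * (LINT z|lebesgue. N r z) - k4 * measure lebesgue A"
      unfolding G_def using cN(2)[OF that(1)] cN(2)[OF r(1)] cF(2)[OF that(1)] iA A by simp
    also have "\<dots> \<le> k1 * (cN * R powr (2 - 2 * s)) + k2 * (cF * R powr (\<sigma> - 2 * s)) + k3 * (cN * r powr (2 - 2 * s)) - k4 * measure lebesgue A"
      using cN(3)[OF that(1)] cN(3)[OF r(1)] cF(3)[OF that(1)] that(2,3) L
      by (intro diff_right_mono add_mono mult_left_mono) (auto simp: k1_def k2_def k3_def)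
    also have "k1 * (cN * R powr (2 - 2 * s)) + k2 * (cF * R powr (\<sigma> - 2 * s)) = 2 * (C * T * R powr (\<sigma> - 2 * s))"
    proof -
      have "R powr (\<sigma> - 2) * R powr (2 - 2 * s) = R powr (\<sigma> - 2 * s)" by (simp flip: powr_add)
      then have "k1 * (cN * R powr (2 - 2 * s)) = 2 * T * L * cN * R powr (\<sigma> - 2 * s)"
        by (simp add: k1_def mult_ac)
      then show ?thesis by (simp add: k2_def C_def algebra_simps)
    qed
    also have "k3 * (cN * r powr (2 - 2 * s)) \<le> 2 * (c * E * b powr (\<alpha> - 2 * s))"
    proof -
      have "b powr (\<alpha> - 2) * b powr (2 - 2 * s) = b powr (\<alpha> - 2 * s)" by (simp flip: powr_add)
      then have "k3 * (cN * r powr (2 - 2 * s)) = 2 * E * b powr (\<alpha> - 2 * s) * (L * cN * \<kappa> powr (2 - 2 * s))"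
        using \<kappa> b by (simp add: k3_def r_def powr_mult mult_ac)
      also have "\<dots> \<le> 2 * E * b powr (\<alpha> - 2 * s) * c"
        using \<kappa>c that by (intro mult_left_mono) auto
      finally show ?thesis by (simp add: mult_ac)
    qed
    also have "k4 * measure lebesgue A = 4 * (c * E * b powr (\<alpha> - 2 * s))"
    proof -
      have "b powr \<alpha> * (1 / b powr m) * b powr ?n = b powr (\<alpha> - 2 * s)"
        using b by (simp add: m_def powr_add powr_diff)
      moreover have "k4 * measure lebesgue A = 4 * (c * E * (b powr \<alpha> * (1 / b powr m) * b powr ?n))"
        by (simp add: k4_def mA c_def)
      ultimately show ?thesis by (simp only:)
    qed
    finally have "(LINT z|lebesgue. S z) / 2 \<le> C * T * R powr (\<sigma> - 2 * s) - c * E * b powr (\<alpha> - 2 * s)"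
      by linarith
    then show ?thesis using LS by (simp add: v_def w_def r_def b_def)
  qed
  show ?thesis
    by (rule exI[of _ c], rule exI[of _ C], rule exI[of _ \<kappa>], intro conjI allI impI c C \<kappa>,
        elim conjE IntE, rule main) (assumption | blast)+
qed

section \<open>From viscosity solutions to an inequality at a maximum point\<close>

lemma continuous_on_rpow: "0 \<le> c \<Longrightarrow> 0 < p \<Longrightarrow> continuous_on S (rpow c y p)"
  unfolding rpow_def by (intro continuous_on_powr' continuous_intros) auto

lemma visc_sol_above:
  assumes "visc_sol s I UNIV U H u" "0 < r" "C2_on (ball x r) \<phi>" "u x = \<phi> x" "\<forall>\<xi>\<in>ball x r. u \<xi> \<le> \<phi> \<xi>"
    "glue x r \<phi> u \<in> L1_omega s"
  shows "- I (glue x r \<phi> u) x + H x (u x) (grad \<phi> x) \<le> 0"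
proof -
  have "\<forall>x0\<in>UNIV. \<forall>r>0. \<forall>\<phi>. C2_on (ball x0 r) \<phi> \<and> u x0 = \<phi> x0 \<and> (\<forall>x\<in>ball x0 r. u x \<le> \<phi> x) \<and>
        glue x0 r \<phi> u \<in> L1_omega s \<longrightarrow> - I (glue x0 r \<phi> u) x0 + H x0 (u x0) (grad \<phi> x0) \<le> 0"
    using assms(1) unfolding visc_sol_def visc_subsol_def by (elim conjE)
  from this[THEN bspec, OF UNIV_I, THEN spec, THEN mp, OF assms(2), THEN spec, THEN mp] assms(3-6)
  show ?thesis by simp
qed

lemma visc_sol_below:
  assumes "visc_sol s I UNIV U H u" "0 < r" "C2_on (ball x r) \<phi>" "u x = \<phi> x" "\<forall>\<xi>\<in>ball x r. u \<xi> \<ge> \<phi> \<xi>"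
    "glue x r \<phi> u \<in> L1_omega s"
  shows "- I (glue x r \<phi> u) x + H x (u x) (grad \<phi> x) \<ge> 0"
proof -
  have "\<forall>x0\<in>UNIV. \<forall>r>0. \<forall>\<phi>. C2_on (ball x0 r) \<phi> \<and> u x0 = \<phi> x0 \<and> (\<forall>x\<in>ball x0 r. u x \<ge> \<phi> x) \<and>
        glue x0 r \<phi> u \<in> L1_omega s \<longrightarrow> - I (glue x0 r \<phi> u) x0 + H x0 (u x0) (grad \<phi> x0) \<ge> 0"
    using assms(1) unfolding visc_sol_def visc_supersol_def by (elim conjE)
  from this[THEN bspec, OF UNIV_I, THEN spec, THEN mp, OF assms(2), THEN spec, THEN mp] assms(3-6)
  show ?thesis by simp
qed

text \<open>The subsolution test at \<open>x\<close> is subtracted from the supersolution test at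
  \<open>y\<close>; the equation has no gradient term, so what remains is a difference of values of
  \<open>I\<close>. Ellipticity compares functions at one point, so the upper function is first
  translated to \<open>y\<close>.\<close>

lemma viscosity_doubling_inequality:
  fixes s l L \<alpha> \<sigma> :: real and I :: "('a::euclidean_space \<Rightarrow> real) \<Rightarrow> 'a \<Rightarrow> real"
  assumes s: "0 < s" "s < 1" and lL: "0 < l" "l \<le> L" and \<alpha>: "0 < \<alpha>" "\<alpha> < 1" and \<sigma>: "0 < \<sigma>" "\<sigma> < 2 * s"
    and trans: "translation_invariant_op s I" and ell: "elliptic_op s l L I"
  shows "\<exists>c C. 0 < c \<and> 0 \<le> C \<and>
    (\<forall>f u R T E x y. visc_sol s I UNIV {0<..} (\<lambda>x t p. - f t) u \<and> 0 < R \<and> 0 \<le> T \<and> 0 < E \<and> x \<noteq> y \<and> norm x \<le> R \<and>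
       (\<forall>x' y'. doubling u R T E \<alpha> \<sigma> x' y' \<le> doubling u R T E \<alpha> \<sigma> x y) \<longrightarrow>
       f (u y) - f (u x) \<le> C * T * R powr (\<sigma> - 2 * s) - c * E * norm (x - y) powr (\<alpha> - 2 * s))"
proof -
  obtain c C \<kappa> where c: "0 < c" "0 \<le> C" "0 < \<kappa>" "\<kappa> \<le> 1/8" and est:
    "\<And>(u :: 'a \<Rightarrow> real) R T E x y K. 0 < R \<and> 0 \<le> T \<and> 0 < E \<and> x \<noteq> y \<and> norm x \<le> R \<and>
       (\<forall>x' y'. doubling u R T E \<alpha> \<sigma> x' y' \<le> doubling u R T E \<alpha> \<sigma> x y) \<and> K \<in> K_sym s l L \<and>
       glue x (\<kappa> * norm (x - y)) (test_above u R T E \<alpha> \<sigma> x y) u \<in> C11_at x \<inter> L1_omega s \<and>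
       glue y (\<kappa> * norm (x - y)) (test_below u E \<alpha> x y) u \<in> C11_at y \<inter> L1_omega s \<Longrightarrow>
       L_op s K (glue x (\<kappa> * norm (x - y)) (test_above u R T E \<alpha> \<sigma> x y) u) x
        - L_op s K (glue y (\<kappa> * norm (x - y)) (test_below u E \<alpha> x y) u) y
       \<le> C * T * R powr (\<sigma> - 2 * s) - c * E * norm (x - y) powr (\<alpha> - 2 * s)"
    using L_op_doubling_estimate[OF s lL \<alpha> \<sigma>, where 'a='a] by metis
  have main: "f (u y) - f (u x) \<le> C * T * R powr (\<sigma> - 2 * s) - c * E * norm (x - y) powr (\<alpha> - 2 * s)"
    if sol: "visc_sol s I UNIV {0<..} (\<lambda>x t p. - f t) u" and R: "0 < R" and T: "0 \<le> T" and E: "0 < E"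
      and xy: "x \<noteq> y" and xR: "norm x \<le> R"
      and max: "\<And>x' y'. doubling u R T E \<alpha> \<sigma> x' y' \<le> doubling u R T E \<alpha> \<sigma> x y"
    for f u R T E x y
  proof -
    define r where "r = \<kappa> * norm (x - y)"
    \<comment> \<open>The gluing balls avoid the singularity of the modulus: \<open>y\<close> is not
      in the ball about \<open>x\<close>, nor \<open>x\<close> in the ball about \<open>y\<close>.
      Hence the test functions are smooth there, and they are continuous everywhere.\<close>
    have r: "0 < r" "r < norm (x - y)"
    proof -
      have "\<kappa> * norm (x - y) \<le> 1/8 * norm (x - y)" using c by (intro mult_right_mono) auto
      then show "0 < r" "r < norm (x - y)" using c xy by (auto simp: r_def)
    qed
    define \<phi> where "\<phi> = test_above u R T E \<alpha> \<sigma> x y"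
    define \<zeta> where "\<zeta> = test_below u E \<alpha> x y"
    define v where "v = glue x r \<phi> u"
    define w where "w = glue y r \<zeta> u"
    have u: "u \<in> L1_omega s" using sol by (simp add: visc_sol_def visc_subsol_def)
    have \<phi>c: "continuous_on UNIV \<phi>"
      unfolding \<phi>_def test_above_def using \<alpha> \<sigma> by (intro continuous_intros continuous_on_rpow) auto
    have \<zeta>c: "continuous_on UNIV \<zeta>"
      unfolding \<zeta>_def test_below_def using \<alpha> \<sigma> by (intro continuous_intros continuous_on_rpow) auto
    have \<phi>2: "C2_on (ball x r) \<phi>"
      unfolding \<phi>_def test_above_def using r R
      by (intro C2_on_linear_combination C2_on_rpow) (auto simp: dist_norm intro: add_pos_nonneg)
    have \<zeta>2: "C2_on (ball y r) \<zeta>"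
      unfolding \<zeta>_def test_below_def using r
      by (intro C2_on_linear_combination C2_on_rpow) (auto simp: dist_norm norm_minus_commute)
    have v: "v \<in> C11_at x" "v \<in> L1_omega s"
      unfolding v_def using C11_at_if_C2_on[OF \<phi>2 r(1)] \<phi>c u s r
      by (auto intro!: glue_in_C11_at glue_in_L1_omega)
    have w: "w \<in> C11_at y" "w \<in> L1_omega s"
      unfolding w_def using C11_at_if_C2_on[OF \<zeta>2 r(1)] \<zeta>c u s r
      by (auto intro!: glue_in_C11_at glue_in_L1_omega)
    have \<phi>x: "u x = \<phi> x" "\<forall>\<xi>\<in>ball x r. u \<xi> \<le> \<phi> \<xi>"
      using max[of _ y] by (auto simp: \<phi>_def test_above_def doubling_def rpow_zero algebra_simps)
    have \<zeta>y: "u y = \<zeta> y" "\<forall>\<eta>\<in>ball y r. u \<eta> \<ge> \<zeta> \<eta>"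
      using max[of x] by (auto simp: \<zeta>_def test_below_def doubling_def rpow_zero norm_minus_commute algebra_simps)
    have "- I v x + - f (u x) \<le> 0"
      using visc_sol_above[OF sol r(1) \<phi>2 \<phi>x v(2)[unfolded v_def]] unfolding v_def .
    moreover have "- I w y + - f (u y) \<ge> 0"
      using visc_sol_below[OF sol r(1) \<zeta>2 \<zeta>y w(2)[unfolded w_def]] unfolding w_def .
    ultimately have "f (u y) - f (u x) \<le> I v x - I w y" by linarith
    also have "I v x = I (\<lambda>z. v ((x - y) + z)) y"
    proof -
      have "v \<in> C11_at (y + (x - y)) \<inter> L1_omega s \<longrightarrow> I (\<lambda>z. v (z + (x - y))) y = I v (y + (x - y))"
        using trans unfolding translation_invariant_op_def by (elim allE)
      then show ?thesis using v by (simp add: add.commute)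
    qed
    also have "\<dots> - I w y \<le> (SUP K\<in>K_sym s l L. L_op s K (\<lambda>z. v ((x - y) + z)) y - L_op s K w y)"
    proof -
      have v': "(\<lambda>z. v ((x - y) + z)) \<in> C11_at y" "(\<lambda>z. v ((x - y) + z)) \<in> L1_omega s"
        using C11_at_shift[of v y "x - y"] L1_omega_shift[OF v(2), of "x - y"] v s by auto
      then show ?thesis using ell w unfolding elliptic_op_def by blast
    qed
    also have "\<dots> \<le> C * T * R powr (\<sigma> - 2 * s) - c * E * norm (x - y) powr (\<alpha> - 2 * s)"
    proof (rule cSUP_least)
      show "K_sym s l L \<noteq> ({} :: ('a \<Rightarrow> real) set)" by (rule K_sym_nonempty[OF lL])
      fix K :: "'a \<Rightarrow> real" assume K: "K \<in> K_sym s l L"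
      have v': "(\<lambda>z. v ((x - y) + z)) \<in> C11_at y" "(\<lambda>z. v ((x - y) + z)) \<in> L1_omega s"
        using C11_at_shift[of v y "x - y"] L1_omega_shift[OF v(2), of "x - y"] v s by auto
      \<comment> \<open>In second-difference form translation invariance of the linear operator is
        immediate, without computing the gradient of the translate.\<close>
      have "L_op s K (\<lambda>z. v ((x - y) + z)) y = L_op s K v x"
        unfolding L_op_second_difference(2)[OF K v' s] L_op_second_difference(2)[OF K v s]
        by (simp add: algebra_simps)
      then show "L_op s K (\<lambda>z. v ((x - y) + z)) y - L_op s K w y
          \<le> C * T * R powr (\<sigma> - 2 * s) - c * E * norm (x - y) powr (\<alpha> - 2 * s)"
        using est[of R T E x y u K] R T E xy xR max K v w
        unfolding v_def w_def r_def \<phi>_def \<zeta>_def by simp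
    qed
    finally show ?thesis .
  qed
  show ?thesis
    by (rule exI[of _ c], rule exI[of _ C], intro conjI allI impI c(1,2), elim conjE, rule main) (assumption | blast)+
qed

text \<open>For \<open>norm x \<ge> R\<close> the radicand is at least \<open>2 * R^2\<close>, so
  subtracting \<open>R powr \<sigma>\<close> removes only the fraction
  \<open>2 powr (- \<sigma>/2)\<close> of the penalty. What is left is comparable to
  \<open>norm x powr \<sigma>\<close>, and \<open>\<gamma> < \<sigma>\<close> gives \<open>norm x
  powr \<gamma> \<le> R powr (\<gamma> - \<sigma>) * norm x powr \<sigma>\<close>.\<close>

lemma penalty_dominates_growth:
  fixes x :: "'a::euclidean_space"
  assumes "0 < \<gamma>" "\<gamma> < \<sigma>" "0 \<le> C" "1 \<le> R" "R \<le> norm x"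
  shows "C * (1 + norm x) powr \<gamma>
    \<le> C * 2 powr \<gamma> / (1 - 2 powr (- \<sigma>/2)) * R powr (\<gamma> - \<sigma>) * (rpow (R\<^sup>2) 0 (\<sigma>/2) x - R powr \<sigma>)"
proof -
  define q where "q = 2 powr (- \<sigma>/2)"
  have nx: "0 < norm x" using assms by linarith
  have q: "q < 1" "q * 2 powr (\<sigma>/2) = 1" 
    using assms by (auto simp: q_def powr_less_one simp flip: powr_add)
  have sq: "(t\<^sup>2) powr (\<sigma>/2) = t powr \<sigma>" if "t > 0" for t :: real
    using that by (simp add: powr_powr flip: powr_numeral)
  have "(2 * R\<^sup>2) powr (\<sigma>/2) \<le> rpow (R\<^sup>2) 0 (\<sigma>/2) x"
    unfolding rpow_def using assms power_mono[of R "norm x" 2] by (intro powr_mono2) auto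
  then have "2 powr (\<sigma>/2) * R powr \<sigma> \<le> rpow (R\<^sup>2) 0 (\<sigma>/2) x"
    using assms by (simp add: powr_mult sq)
  then have "q * (2 powr (\<sigma>/2) * R powr \<sigma>) \<le> q * rpow (R\<^sup>2) 0 (\<sigma>/2) x"
    by (intro mult_left_mono) (auto simp: q_def)
  then have 1: "(1 - q) * rpow (R\<^sup>2) 0 (\<sigma>/2) x \<le> rpow (R\<^sup>2) 0 (\<sigma>/2) x - R powr \<sigma>"
    unfolding mult.assoc[symmetric] q(2) left_diff_distrib by simp
  have "norm x powr \<sigma> = ((norm (x - 0))\<^sup>2) powr (\<sigma>/2)"
    using sq[OF nx] by simp
  also have "\<dots> \<le> rpow (R\<^sup>2) 0 (\<sigma>/2) x"
    unfolding rpow_def using assms by (intro powr_mono2) auto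
  finally have "(1 - q) * norm x powr \<sigma> \<le> (1 - q) * rpow (R\<^sup>2) 0 (\<sigma>/2) x"
    using q by (intro mult_left_mono) auto
  with 1 have "(1 - q) * norm x powr \<sigma> \<le> rpow (R\<^sup>2) 0 (\<sigma>/2) x - R powr \<sigma>" by linarith
  then have 2: "C * 2 powr \<gamma> / (1 - q) * R powr (\<gamma> - \<sigma>) * ((1 - q) * norm x powr \<sigma>)
     \<le> C * 2 powr \<gamma> / (1 - q) * R powr (\<gamma> - \<sigma>) * (rpow (R\<^sup>2) 0 (\<sigma>/2) x - R powr \<sigma>)"
    using q assms by (intro mult_left_mono) auto
  have "norm x powr (\<gamma> - \<sigma>) \<le> R powr (\<gamma> - \<sigma>)" using assms by (intro powr_mono2') auto
  then have "norm x powr (\<gamma> - \<sigma>) * norm x powr \<sigma> \<le> R powr (\<gamma> - \<sigma>) * norm x powr \<sigma>"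
    by (intro mult_right_mono) auto
  then have 3: "norm x powr \<gamma> \<le> R powr (\<gamma> - \<sigma>) * norm x powr \<sigma>" by (simp flip: powr_add)
  have "(1 + norm x) powr \<gamma> \<le> (2 * norm x) powr \<gamma>" using assms by (intro powr_mono2) auto
  also have "\<dots> \<le> 2 powr \<gamma> * (R powr (\<gamma> - \<sigma>) * norm x powr \<sigma>)"
    using 3 by (simp add: powr_mult)
  finally have "C * (1 + norm x) powr \<gamma> \<le> C * (2 powr \<gamma> * (R powr (\<gamma> - \<sigma>) * norm x powr \<sigma>))"
    using assms by (intro mult_left_mono) auto
  also have "\<dots> = C * 2 powr \<gamma> / (1 - q) * R powr (\<gamma> - \<sigma>) * ((1 - q) * norm x powr \<sigma>)"
    using q by simp
  finally show ?thesis using 2 unfolding q_def by linarith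
qed

text \<open>Pairs above the level \<open>- T * R powr \<sigma>\<close> lie in a compact set:
  positivity discards \<open>- u y\<close>, the penalty beats the growth of \<open>u\<close> once
  \<open>norm x \<ge> R\<close>, and the modulus then bounds \<open>norm (x - y)\<close>. On the
  diagonal the function never exceeds this level, so the maximum is off the diagonal.\<close>

lemma doubling_attains_max:
  fixes u :: "'a::euclidean_space \<Rightarrow> real"
  assumes cont: "continuous_on UNIV u" and pos: "\<And>x. 0 < u x" and gr: "\<And>x. u x \<le> C * (1 + norm x) powr \<gamma>"
    and \<gamma>: "0 < \<gamma>" "\<gamma> < \<sigma>" and C: "0 \<le> C" and R: "1 \<le> R" and E: "0 < E" and \<alpha>: "0 < \<alpha>"
    and T: "T = C * 2 powr \<gamma> / (1 - 2 powr (- \<sigma>/2)) * R powr (\<gamma> - \<sigma>)"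
    and start: "- T * R powr \<sigma> < doubling u R T E \<alpha> \<sigma> x0 y0"
  shows "\<exists>x y. x \<noteq> y \<and> norm x \<le> R \<and> E * norm (x - y) powr \<alpha> \<le> u x - u y \<and>
     (\<forall>x' y'. doubling u R T E \<alpha> \<sigma> x' y' \<le> doubling u R T E \<alpha> \<sigma> x y)"
proof -
  have q: "2 powr (- \<sigma>/2) < 1" using \<gamma> by (intro powr_less_one) auto
  have T0: "0 \<le> T" unfolding T using q C by simp
  have \<psi>: "R powr \<sigma> \<le> rpow (R\<^sup>2) 0 (\<sigma>/2) x" for x :: 'a
  proof -
    have "R powr \<sigma> = (R\<^sup>2) powr (\<sigma>/2)" using R by (simp add: powr_powr flip: powr_numeral)
    also have "\<dots> \<le> rpow (R\<^sup>2) 0 (\<sigma>/2) x" unfolding rpow_def using \<gamma> by (intro powr_mono2) auto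
    finally show ?thesis .
  qed
  define B where "B = (C * (1 + R) powr \<gamma> / E) powr (1/\<alpha>)"
  let ?S = "cball (0::'a) R \<times> cball (0::'a) (R + B)"
  have mod: "E * norm (x - y) powr \<alpha> \<le> u x - u y" and S: "(x, y) \<in> ?S"
    if "- T * R powr \<sigma> < doubling u R T E \<alpha> \<sigma> x y" for x y
  proof -
    have *: "T * (rpow (R\<^sup>2) 0 (\<sigma>/2) x - R powr \<sigma>) + E * norm (x - y) powr \<alpha> < u x - u y"
      using that by (simp add: doubling_def algebra_simps)
    moreover have T1: "0 \<le> T * (rpow (R\<^sup>2) 0 (\<sigma>/2) x - R powr \<sigma>)" using T0 \<psi>[of x] by simp
    ultimately show m: "E * norm (x - y) powr \<alpha> \<le> u x - u y" by linarith
    have E0: "0 \<le> E * norm (x - y) powr \<alpha>" using E by simp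
    have x: "norm x < R"
    proof (rule ccontr)
      assume "\<not> norm x < R"
      then have "C * (1 + norm x) powr \<gamma> \<le> T * (rpow (R\<^sup>2) 0 (\<sigma>/2) x - R powr \<sigma>)"
        unfolding T using \<gamma> C R by (intro penalty_dominates_growth) auto
      then show False using * gr[of x] pos[of y] E0 by linarith
    qed
    have "E * norm (x - y) powr \<alpha> \<le> C * (1 + norm x) powr \<gamma>" using m gr[of x] pos[of y] by linarith
    also have "\<dots> \<le> C * (1 + R) powr \<gamma>" using x C \<gamma> by (intro mult_left_mono powr_mono2) auto
    finally have "norm (x - y) powr \<alpha> \<le> C * (1 + R) powr \<gamma> / E" using E by (simp add: field_simps)
    then have "(norm (x - y) powr \<alpha>) powr (1/\<alpha>) \<le> B" unfolding B_def using \<alpha> by (intro powr_mono2) auto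
    then have "norm (x - y) \<le> B" using \<alpha> by (simp add: powr_powr)
    moreover have "norm y \<le> norm x + norm (x - y)" by (metis norm_minus_commute norm_triangle_sub)
    ultimately show "(x, y) \<in> ?S" using x by simp
  qed
  have "continuous_on ?S (\<lambda>p. doubling u R T E \<alpha> \<sigma> (fst p) (snd p))"
    unfolding doubling_def using \<alpha> \<gamma>
    by (intro continuous_intros continuous_on_compose2[OF cont] continuous_on_powr'
        continuous_on_compose2[OF continuous_on_rpow[of _ _ UNIV]]) auto
  moreover have "compact ?S" by (intro compact_Times compact_cball)
  moreover have "?S \<noteq> {}" using S[OF start] by blast
  ultimately obtain p where p: "p \<in> ?S" 
    "\<And>p'. p' \<in> ?S \<Longrightarrow> doubling u R T E \<alpha> \<sigma> (fst p') (snd p') \<le> doubling u R T E \<alpha> \<sigma> (fst p) (snd p)"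
    using continuous_attains_sup[of ?S] by blast
  obtain x y where xy: "p = (x, y)" by (cases p)
  \<comment> \<open>Inside the level set the point lies in \<open>?S\<close>; outside it the value
    is below that of the starting pair.\<close>
  have max: "doubling u R T E \<alpha> \<sigma> x' y' \<le> doubling u R T E \<alpha> \<sigma> x y" for x' y'
    using p(2)[of "(x', y')"] p(2)[OF S[OF start]] S[of x' y'] start xy
    by (cases "- T * R powr \<sigma> < doubling u R T E \<alpha> \<sigma> x' y'") auto
  have lt: "- T * R powr \<sigma> < doubling u R T E \<alpha> \<sigma> x y" using start max[of x0 y0] by linarith
  have "x \<noteq> y"
  proof
    assume "x = y"
    then have "T * rpow (R\<^sup>2) 0 (\<sigma>/2) x < T * R powr \<sigma>" using lt \<alpha> by (simp add: doubling_def)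
    then show False using mult_left_mono[OF \<psi>[of x] T0] by linarith
  qed
  then show ?thesis using p(1) xy mod[OF lt] max by (intro exI[of _ x] exI[of _ y]) auto
qed

lemma continuous_on_if_usc_lsc:
  assumes "usc_on S u" "lsc_on S u"
  shows "continuous_on S u"
  unfolding continuous_on_def
proof
  fix x assume x: "x \<in> S"
  show "(u \<longlongrightarrow> u x) (at x within S)"
    using assms x by (intro order_tendstoI) (auto simp: usc_on_def lsc_on_def)
qed

text \<open>The common input of both Liouville arguments. The choice of \<open>T\<close> eliminates
  \<open>\<sigma>\<close>: the cost \<open>T * R powr (\<sigma> - 2 * s)\<close> becomes a multiple
  of \<open>R powr (\<gamma> - 2 * s)\<close>, and the penalty at the fixed starting point a
  multiple of \<open>R powr (\<gamma> - 2)\<close>.\<close>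

lemma viscosity_doubling_alternative:
  fixes s l L \<alpha> \<gamma> :: real and I :: "('a::euclidean_space \<Rightarrow> real) \<Rightarrow> 'a \<Rightarrow> real"
  assumes s: "0 < s" "s < 1" and lL: "0 < l" "l \<le> L" and \<alpha>: "0 < \<alpha>" "\<alpha> < 1"
    and op: "translation_invariant_op s I" "elliptic_op s l L I"
    and sol: "visc_sol s I UNIV {0<..} (\<lambda>x t p. - f t) u" and pos: "\<And>x. 0 < u x"
    and gr: "\<And>x. u x \<le> C * (1 + norm x) powr \<gamma>" and \<gamma>: "0 < \<gamma>" "\<gamma> < 2 * s" and C: "0 \<le> C"
  shows "\<exists>c D. 0 < c \<and> 0 \<le> D \<and> (\<forall>R E x0 y0. 1 \<le> R \<and> 0 < E \<and>
      E * norm (x0 - y0) powr \<alpha> + D * R powr (\<gamma> - 2) * (norm x0)\<^sup>2 < u x0 - u y0 \<longrightarrow>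
      (\<exists>x y. x \<noteq> y \<and> E * norm (x - y) powr \<alpha> \<le> u x - u y \<and> u x \<le> C * 2 powr \<gamma> * R powr \<gamma> \<and>
        f (u y) - f (u x) + c * E * norm (x - y) powr (\<alpha> - 2 * s) \<le> D * R powr (\<gamma> - 2 * s)))"
proof -
  \<comment> \<open>The midpoint: above \<open>\<gamma>\<close> so that the penalty beats the
    growth, below \<open>2 * s\<close> so that its tail is integrable.\<close>
  define \<sigma> where "\<sigma> = (\<gamma> + 2 * s) / 2"
  have \<sigma>: "0 < \<sigma>" "\<gamma> < \<sigma>" "\<sigma> < 2 * s" "\<sigma> < 2" using \<gamma> s by (auto simp: \<sigma>_def)
  obtain c C1 where c: "0 < c" "0 \<le> C1" and ineq: "\<And>f u R T E x y. visc_sol s I UNIV {0<..} (\<lambda>x t p. - f t) u \<and> 0 < R \<and> 0 \<le> T \<and> 0 < E \<and> x \<noteq> y \<and> norm x \<le> R \<and>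
       (\<forall>x' y'. doubling u R T E \<alpha> \<sigma> x' y' \<le> doubling u R T E \<alpha> \<sigma> x y) \<Longrightarrow>
       f (u y) - f (u x) \<le> C1 * T * R powr (\<sigma> - 2 * s) - c * E * norm (x - y) powr (\<alpha> - 2 * s)"
    using viscosity_doubling_inequality[OF s lL \<alpha> \<sigma>(1,3) op] by metis
  have cont: "continuous_on UNIV u"
    using sol by (intro continuous_on_if_usc_lsc) (auto simp: visc_sol_def visc_subsol_def visc_supersol_def)
  define \<Theta> where "\<Theta> = C * 2 powr \<gamma> / (1 - 2 powr (- \<sigma>/2))"
  have q: "2 powr (- \<sigma>/2) < 1" using \<sigma> by (intro powr_less_one) auto
  have \<Theta>: "0 \<le> \<Theta>" unfolding \<Theta>_def using q C by simp
  \<comment> \<open>The sum serves for both the penalty at the starting point and the right-hand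
    side of the inequality.\<close>
  define D where "D = \<Theta> + C1 * \<Theta>"
  have D: "0 \<le> D" "\<Theta> \<le> D" "C1 * \<Theta> \<le> D" using \<Theta> c by (auto simp: D_def)
  have "\<exists>x y. x \<noteq> y \<and> E * norm (x - y) powr \<alpha> \<le> u x - u y \<and> u x \<le> C * 2 powr \<gamma> * R powr \<gamma> \<and>
        f (u y) - f (u x) + c * E * norm (x - y) powr (\<alpha> - 2 * s) \<le> D * R powr (\<gamma> - 2 * s)"
    if R: "1 \<le> R" and E: "0 < E" and st: "E * norm (x0 - y0) powr \<alpha> + D * R powr (\<gamma> - 2) * (norm x0)\<^sup>2 < u x0 - u y0"
    for R E x0 y0
  proof -
    define T where "T = \<Theta> * R powr (\<gamma> - \<sigma>)"
    have T: "0 \<le> T" using \<Theta> by (simp add: T_def)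
    have start: "- T * R powr \<sigma> < doubling u R T E \<alpha> \<sigma> x0 y0"
    proof -
      \<comment> \<open>The tangent bound at \<open>R^2\<close> keeps the penalty increment at
        \<open>x0\<close> small for large \<open>R\<close>.\<close>
      have "rpow (R\<^sup>2) 0 (\<sigma>/2) x0 \<le> (R\<^sup>2) powr (\<sigma>/2) + \<sigma>/2 * (R\<^sup>2) powr (\<sigma>/2 - 1) * (R\<^sup>2 + (norm (x0 - 0))\<^sup>2 - R\<^sup>2)"
        unfolding rpow_def using R \<sigma> by (intro powr_le_tangent) auto
      also have "(R\<^sup>2) powr (\<sigma>/2) = R powr \<sigma>" using R by (simp add: powr_powr flip: powr_numeral)
      also have "(R\<^sup>2) powr (\<sigma>/2 - 1) = R powr (\<sigma> - 2)"
      proof -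
        have "R\<^sup>2 = R powr 2" "2 * (\<sigma>/2 - 1) = \<sigma> - 2" using R by simp_all
        then show ?thesis by (simp only: powr_powr)
      qed
      finally have "rpow (R\<^sup>2) 0 (\<sigma>/2) x0 - R powr \<sigma> \<le> \<sigma>/2 * (R powr (\<sigma> - 2) * (norm x0)\<^sup>2)" by simp
      also have "\<dots> \<le> 1 * (R powr (\<sigma> - 2) * (norm x0)\<^sup>2)" using \<sigma> by (intro mult_right_mono) auto
      finally have "T * (rpow (R\<^sup>2) 0 (\<sigma>/2) x0 - R powr \<sigma>) \<le> T * (R powr (\<sigma> - 2) * (norm x0)\<^sup>2)"
        using T by (intro mult_left_mono) auto
      also have "\<dots> = \<Theta> * (R powr (\<gamma> - 2) * (norm x0)\<^sup>2)"
        unfolding T_def by (simp add: mult_ac flip: powr_add)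
      also have "\<dots> \<le> D * (R powr (\<gamma> - 2) * (norm x0)\<^sup>2)" using D by (intro mult_right_mono) auto
      finally show ?thesis using st unfolding doubling_def by (simp add: algebra_simps)
    qed
    obtain x y where xy: "x \<noteq> y" "norm x \<le> R" "E * norm (x - y) powr \<alpha> \<le> u x - u y"
      "\<And>x' y'. doubling u R T E \<alpha> \<sigma> x' y' \<le> doubling u R T E \<alpha> \<sigma> x y"
      using doubling_attains_max[OF cont pos gr \<gamma>(1) \<sigma>(2) C R E \<alpha>(1) _ start] by (auto simp: T_def \<Theta>_def)
    have "f (u y) - f (u x) \<le> C1 * T * R powr (\<sigma> - 2 * s) - c * E * norm (x - y) powr (\<alpha> - 2 * s)"
      using ineq sol R T E xy by auto
    also have "C1 * T * R powr (\<sigma> - 2 * s) = C1 * \<Theta> * R powr (\<gamma> - 2 * s)"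
      unfolding T_def by (simp add: mult_ac flip: powr_add)
    also have "\<dots> \<le> D * R powr (\<gamma> - 2 * s)" using D by (intro mult_right_mono) auto
    finally have "f (u y) - f (u x) + c * E * norm (x - y) powr (\<alpha> - 2 * s) \<le> D * R powr (\<gamma> - 2 * s)" by simp
    moreover have "u x \<le> C * 2 powr \<gamma> * R powr \<gamma>"
    proof -
      have "(1 + norm x) powr \<gamma> \<le> (2 * R) powr \<gamma>" using xy R \<gamma> by (intro powr_mono2) auto
      then have "C * (1 + norm x) powr \<gamma> \<le> C * (2 powr \<gamma> * R powr \<gamma>)" using C by (simp add: powr_mult mult_left_mono)
      then show ?thesis using gr[of x] by simp
    qed
    ultimately show ?thesis using xy by blast
  qed
  then show ?thesis using c D by blast
qed

subsection \<open>Liouville theorems\<close>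

text \<open>Since \<open>u y \<le> u x\<close> at the maximum, monotonicity of \<open>f\<close> lets
  its difference be dropped, leaving \<open>c * E * norm (x - y) powr (\<alpha> - 2 * s)\<close>
  against \<open>D * R powr (\<gamma> - 2 * s)\<close>.\<close>

lemma liouville_sublinear:
  fixes s l L \<gamma> :: real and I :: "('a::euclidean_space \<Rightarrow> real) \<Rightarrow> 'a \<Rightarrow> real"
  assumes s: "0 < s" "s < 1" and lL: "0 < l" "l \<le> L"
    and op: "translation_invariant_op s I" "elliptic_op s l L I"
    and f: "antimono_on {0<..} f"
    and sol: "visc_sol s I UNIV {0<..} (\<lambda>x t p. - f t) u" and pos: "\<And>x. 0 < u x"
    and gr: "\<And>x. u x \<le> C * (1 + norm x) powr \<gamma>" and \<gamma>: "0 < \<gamma>" "\<gamma> < min 1 (2 * s)" and C: "0 < C"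
  shows "u x0 \<le> u y0"
proof (rule ccontr)
  assume "\<not> u x0 \<le> u y0"
  then have \<delta>: "0 < u x0 - u y0" by simp
  \<comment> \<open>Strictly between \<open>\<gamma>\<close> and \<open>min 1 (2 * s)\<close>: the
    lower inequality makes \<open>E\<close> tend to 0, the upper one keeps the modulus concave and
    \<open>\<alpha> - 2 * s\<close> negative.\<close>
  define \<alpha> where "\<alpha> = (\<gamma> + min 1 (2 * s)) / 2"
  have \<alpha>: "0 < \<alpha>" "\<alpha> < 1" "\<gamma> < \<alpha>" "\<alpha> < 2 * s" using \<gamma> by (auto simp: \<alpha>_def)
  obtain c D where c: "0 < c" "0 \<le> D" and alt: "\<And>R E x0 y0. 1 \<le> R \<and> 0 < E \<and>
      E * norm (x0 - y0) powr \<alpha> + D * R powr (\<gamma> - 2) * (norm x0)\<^sup>2 < u x0 - u y0 \<Longrightarrow>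
      (\<exists>x y. x \<noteq> y \<and> E * norm (x - y) powr \<alpha> \<le> u x - u y \<and> u x \<le> C * 2 powr \<gamma> * R powr \<gamma> \<and>
        f (u y) - f (u x) + c * E * norm (x - y) powr (\<alpha> - 2 * s) \<le> D * R powr (\<gamma> - 2 * s))"
    using viscosity_doubling_alternative[OF s lL \<alpha>(1,2) op sol pos gr \<gamma>(1)] \<gamma> C by fastforce
  define M where "M = C * 2 powr \<gamma>"
  have M: "0 < M" using C by (simp add: M_def)
  \<comment> \<open>The first entry forces \<open>norm (x - y) \<le> R\<close> through the growth
    bound, the second makes the resulting inequality read \<open>D + 1 \<le> D\<close>.\<close>
  define B where "B = max M ((D + 1) / c)"
  have B: "0 < B" "M \<le> B" "D + 1 \<le> c * B" using M c by (auto simp: B_def field_simps max_def)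
  have "((\<lambda>R. B * R powr (\<gamma> - \<alpha>) * norm (x0 - y0) powr \<alpha> + D * R powr (\<gamma> - 2) * (norm x0)\<^sup>2) \<longlongrightarrow>
      B * 0 * norm (x0 - y0) powr \<alpha> + D * 0 * (norm x0)\<^sup>2) at_top"
    using \<alpha> by (intro tendsto_intros tendsto_neg_powr filterlim_ident) auto
  then have "\<forall>\<^sub>F R in at_top. B * R powr (\<gamma> - \<alpha>) * norm (x0 - y0) powr \<alpha> + D * R powr (\<gamma> - 2) * (norm x0)\<^sup>2 < u x0 - u y0"
    using \<delta> by (intro order_tendstoD) auto
  then have "\<forall>\<^sub>F R in at_top. 1 \<le> R \<and> B * R powr (\<gamma> - \<alpha>) * norm (x0 - y0) powr \<alpha> + D * R powr (\<gamma> - 2) * (norm x0)\<^sup>2 < u x0 - u y0"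
    using eventually_ge_at_top[of "1::real"] by eventually_elim auto
  then obtain R where R: "1 \<le> R" "B * R powr (\<gamma> - \<alpha>) * norm (x0 - y0) powr \<alpha> + D * R powr (\<gamma> - 2) * (norm x0)\<^sup>2 < u x0 - u y0"
    using eventually_happens[of _ "at_top::real filter"] by fastforce
  define E where "E = B * R powr (\<gamma> - \<alpha>)"
  have E: "0 < E" using B R by (simp add: E_def)
  obtain x y where xy: "x \<noteq> y" "E * norm (x - y) powr \<alpha> \<le> u x - u y" "u x \<le> M * R powr \<gamma>"
    "f (u y) - f (u x) + c * E * norm (x - y) powr (\<alpha> - 2 * s) \<le> D * R powr (\<gamma> - 2 * s)"
    using alt[of R E x0 y0] R E unfolding E_def M_def by blast
  have n: "0 < norm (x - y)" using xy(1) by simp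
  have "0 < E * norm (x - y) powr \<alpha>" using E n by simp
  then have "u y \<le> u x" using xy(2) by linarith
  then have "0 \<le> f (u y) - f (u x)" using monotone_onD[OF f, of "u y" "u x"] pos by simp
  with xy(4) have le: "c * E * norm (x - y) powr (\<alpha> - 2 * s) \<le> D * R powr (\<gamma> - 2 * s)" by linarith
  have "B * R powr (\<gamma> - \<alpha>) * norm (x - y) powr \<alpha> \<le> M * R powr \<gamma>"
    using xy(2,3) pos[of y] unfolding E_def by linarith
  also have "\<dots> \<le> B * R powr \<gamma>" using B by (intro mult_right_mono) auto
  also have "R powr \<gamma> = R powr (\<gamma> - \<alpha>) * R powr \<alpha>" by (simp flip: powr_add)
  finally have "norm (x - y) powr \<alpha> \<le> R powr \<alpha>" using B R by simp
  then have "norm (x - y) \<le> R"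
    by (rule contrapos_pp) (use powr_less_mono2[of \<alpha> R "norm (x - y)"] \<alpha> R in auto)
  then have "R powr (\<alpha> - 2 * s) \<le> norm (x - y) powr (\<alpha> - 2 * s)"
    using n \<alpha> by (intro powr_mono2') auto
  then have "c * E * R powr (\<alpha> - 2 * s) \<le> c * E * norm (x - y) powr (\<alpha> - 2 * s)"
    using c E by (intro mult_left_mono) auto
  then have "c * E * R powr (\<alpha> - 2 * s) \<le> D * R powr (\<gamma> - 2 * s)" using le by linarith
  moreover have "c * E * R powr (\<alpha> - 2 * s) = c * B * R powr (\<gamma> - 2 * s)"
    unfolding E_def by (simp flip: powr_add)
  ultimately have "c * B \<le> D" using R by simp
  then show False using B by linarith
qed

text \<open>The slope bound gives the damping term that replaces \<open>\<gamma> < 1\<close>: the difference of \<open>f\<close> is at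
  least \<open>m (u x - u y)\<close>, where \<open>m\<close> is the slope of \<open>f\<close> at the largest relevant value of \<open>u\<close>.\<close>

lemma convex_antimono_slope:
  fixes f :: "real \<Rightarrow> real"
  assumes C1: "f C1_differentiable_on {0<..}" and cv: "convex_on {0<..} f" and mono: "antimono_on {0<..} f"
    and t: "0 < Y" "Y \<le> X" "X \<le> t"
  shows "\<bar>deriv f t\<bar> * (X - Y) \<le> f Y - f X" and "\<bar>deriv f t\<bar> \<le> \<bar>deriv f X\<bar>"
proof -
  obtain D where D: "\<And>x. x > 0 \<Longrightarrow> (f has_vector_derivative D x) (at x)"
    using C1 unfolding C1_differentiable_on_def by (auto simp: greaterThan_iff)
  then have D: "(f has_real_derivative D x) (at x)" if "x > 0" for x
    using that by (simp add: has_real_derivative_iff_has_vector_derivative)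
  then have dD: "deriv f x = D x" if "x > 0" for x using that by (simp add: DERIV_imp_deriv)
  have tan: "D a * (b - a) \<le> f b - f a" if "0 < a" "0 < b" for a b
    using convex_on_imp_above_tangent[OF cv, of a b "D a"] that D[of a]
    by (simp add: interior_open has_field_derivative_at_within)
  have neg: "D a \<le> 0" if "0 < a" for a
    using tan[of a "a + 1"] monotone_onD[OF mono, of a "a + 1"] that by simp
  \<comment> \<open>The tangent inequalities at \<open>X\<close> and at \<open>t\<close> add up to
    monotonicity of the derivative, which is nonpositive; so its absolute value decreases.\<close>
  have XT: "D X \<le> D t"
  proof (cases "X = t")
    case False
    have "0 \<le> (D t - D X) * (t - X)"
      using tan[of X t] tan[of t X] t by (simp add: algebra_simps)
    then show ?thesis using False t by (simp add: zero_le_mult_iff)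
  qed simp
  have p: "0 < X" "0 < t" using t by auto
  show "\<bar>deriv f t\<bar> \<le> \<bar>deriv f X\<bar>" using XT neg[of X] neg[of t] dD p by simp
  have "\<bar>deriv f t\<bar> * (X - Y) \<le> - D X * (X - Y)"
    using XT neg[of t] dD p t by (intro mult_right_mono) auto
  also have "\<dots> = D X * (Y - X)" by (simp add: algebra_simps)
  also have "\<dots> \<le> f Y - f X" using tan[of X Y] t p by simp
  finally show "\<bar>deriv f t\<bar> * (X - Y) \<le> f Y - f X" .
qed

text \<open>One term increases in \<open>b\<close>, the other decreases. At
  \<open>d = m powr (- 1 / (2 * s))\<close> both equal the claimed power of \<open>m\<close> up to
  the factor \<open>c\<close>, so on either side of \<open>d\<close> a single term suffices.\<close>

lemma damped_power_lower_bound: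
  fixes m b c s \<alpha> :: real
  assumes "0 < m" "0 < b" "0 < c" "0 < \<alpha>" "\<alpha> < 2 * s"
  shows "min 1 c * m powr ((2 * s - \<alpha>) / (2 * s)) \<le> m * b powr \<alpha> + c * b powr (\<alpha> - 2 * s)"
proof -
  define d where "d = m powr (- 1 / (2 * s))"
  have d: "0 < d" using assms by (simp add: d_def)
  have e1: "m * d powr \<alpha> = m powr ((2 * s - \<alpha>) / (2 * s))"
  proof -
    have "m * d powr \<alpha> = m powr (1 + - \<alpha> / (2 * s))"
      using assms powr_mult_base[of m "- \<alpha> / (2 * s)"] by (simp add: d_def powr_powr)
    also have "1 + - \<alpha> / (2 * s) = (2 * s - \<alpha>) / (2 * s)"
      using assms by (simp add: diff_divide_distrib)
    finally show ?thesis .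
  qed
  have e2: "d powr (\<alpha> - 2 * s) = m powr ((2 * s - \<alpha>) / (2 * s))"
  proof -
    have "- 1 / (2 * s) * (\<alpha> - 2 * s) = (2 * s - \<alpha>) / (2 * s)"
      using assms by (simp add: field_simps)
    then show ?thesis by (simp only: d_def powr_powr)
  qed
  show ?thesis
  proof (cases "d \<le> b")
    case True
    have "min 1 c * m powr ((2 * s - \<alpha>) / (2 * s)) \<le> 1 * (m * d powr \<alpha>)"
      unfolding e1 by (intro mult_right_mono) auto
    also have "\<dots> \<le> m * b powr \<alpha>"
      using True assms d by (simp add: powr_mono2)
    finally show ?thesis using assms by (simp add: add_increasing2)
  next
    case False
    have "min 1 c * m powr ((2 * s - \<alpha>) / (2 * s)) \<le> c * d powr (\<alpha> - 2 * s)"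
      unfolding e2 by (intro mult_right_mono) auto
    also have "\<dots> \<le> c * b powr (\<alpha> - 2 * s)"
      using False assms by (intro mult_left_mono powr_mono2') auto
    finally show ?thesis using assms by (simp add: add_increasing)
  qed
qed

text \<open>With \<open>\<alpha> < 1 \<le> \<gamma>\<close> the choice \<open>E\<close> of order
  \<open>R powr (\<gamma> - \<alpha>)\<close> would not tend to 0, and a small \<open>E\<close> does
  not confine \<open>norm (x - y)\<close> to \<open>R\<close>. The damping from the slope of
  \<open>f\<close> gives a lower bound valid for every distance.\<close>

lemma liouville_damped:
  fixes s l L \<gamma> \<beta> :: real and I :: "('a::euclidean_space \<Rightarrow> real) \<Rightarrow> 'a \<Rightarrow> real"
  assumes s: "1/2 < s" "s < 1" and lL: "0 < l" "l \<le> L"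
    and op: "translation_invariant_op s I" "elliptic_op s l L I"
    and f: "antimono_on {0<..} f" "f C1_differentiable_on {0<..}" "convex_on {0<..} f"
    and \<beta>: "0 < \<beta>" "\<beta> < 1"
    and lim: "Limsup at_top (\<lambda>R::real. ereal (R powr (2 * s - (2 - \<beta>) * \<gamma>) *
               \<bar>deriv f (R powr \<gamma>)\<bar> powr ((2 * s - 1) / (2 * s)))) = \<infinity>"
    and sol: "visc_sol s I UNIV {0<..} (\<lambda>x t p. - f t) u" and pos: "\<And>x. 0 < u x"
    and gr: "\<And>x. u x \<le> C * (1 + norm x) powr \<gamma>" and \<gamma>: "1 \<le> \<gamma>" and C: "0 < C"
  shows "u x0 \<le> u y0"
proof (rule ccontr)
  assume "\<not> u x0 \<le> u y0"
  then have \<delta>: "0 < u x0 - u y0" by simp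
  define p where "p = 2 * s - (2 - \<beta>) * \<gamma>"
  define \<theta> where "\<theta> = (2 * s - 1) / (2 * s)"
  have \<theta>: "0 < \<theta>" using s by (simp add: \<theta>_def)
  define g where "g R = R powr p * \<bar>deriv f (R powr \<gamma>)\<bar> powr \<theta>" for R
  \<comment> \<open>Exceeding 1 bounds the slope from below; exceeding the second entry will force
    \<open>p > 0\<close>.\<close>
  define N where "N = max 1 (\<bar>deriv f 1\<bar> powr \<theta>)"
  have freq: "\<exists>\<^sub>F R in at_top. N < g R"
  proof (rule ccontr)
    assume "\<not> ?thesis"
    then have "\<forall>\<^sub>F R in at_top. ereal (g R) \<le> ereal N"
      by (simp add: frequently_def not_less)
    then have "Limsup at_top (\<lambda>R. ereal (g R)) \<le> ereal N" by (rule Limsup_bounded)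
    then show False using lim unfolding g_def p_def \<theta>_def by simp
  qed
  \<comment> \<open>For \<open>p \<le> 0\<close> and \<open>T \<ge> 1\<close> the power factor is at
    most 1 and the slope at most that at 1, so \<open>g\<close> could not exceed
    \<open>N\<close>.\<close>
  have p: "0 < p"
  proof (rule ccontr)
    assume np: "\<not> 0 < p"
    obtain T where T: "1 \<le> T" "N < g T"
      using frequently_eventually_conj[OF freq eventually_ge_at_top[of 1]] frequently_ex by blast
    have "\<bar>deriv f (T powr \<gamma>)\<bar> \<le> \<bar>deriv f 1\<bar>"
      using convex_antimono_slope(2)[OF f(2,3,1), of 1 1 "T powr \<gamma>"] T \<gamma> ge_one_powr_ge_zero[of T \<gamma>] by simp
    then have "g T \<le> 1 * \<bar>deriv f 1\<bar> powr \<theta>"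
      unfolding g_def using T np \<theta> powr_mono[of p 0 T] by (intro mult_mono powr_mono2) auto
    then show False using T by (simp add: N_def)
  qed
  have \<gamma>2: "\<gamma> < 2 * s"
  proof -
    have "1 * \<gamma> \<le> (2 - \<beta>) * \<gamma>" using \<beta> \<gamma> by (intro mult_right_mono) auto
    then show ?thesis using p by (simp add: p_def)
  qed
  \<comment> \<open>Since \<open>- p = \<gamma> - 2 * s + 2 * \<epsilon>\<close>, the assumption
    \<open>\<beta> < 1\<close> leaves room \<open>2 * \<epsilon>\<close>: half is spent on taking
    \<open>\<alpha> < 1\<close>, half on letting \<open>E\<close> tend to 0.\<close>
  define \<epsilon> where "\<epsilon> = (1 - \<beta>) * \<gamma> / 2"
  have \<epsilon>: "0 < \<epsilon>" "- p - \<epsilon> = \<gamma> - 2 * s + \<epsilon>" using \<beta> \<gamma> by (auto simp: \<epsilon>_def p_def field_simps)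
  define P where "P = p / (2 * s - 1)"
  have P: "0 < P" using p s by (simp add: P_def)
  \<comment> \<open>Close enough to 1 that the exponent excess
    \<open>(1 - \<alpha>) / (2 * s)\<close> over \<open>\<theta>\<close> costs at most
    \<open>T powr (- \<epsilon>)\<close>; the entry 1/2 keeps it positive.\<close>
  define \<alpha> where "\<alpha> = max (1/2) (1 - \<epsilon> / P)"
  have \<alpha>: "0 < \<alpha>" "\<alpha> < 1" "(1 - \<alpha>) * P \<le> \<epsilon>" "\<alpha> < 2 * s"
  proof -
    have "1 - \<epsilon> / P \<le> \<alpha>" by (simp add: \<alpha>_def)
    then have "1 - \<alpha> \<le> \<epsilon> / P" by simp
    then show "(1 - \<alpha>) * P \<le> \<epsilon>" using P by (simp add: pos_le_divide_eq)
    show "0 < \<alpha>" by (simp add: \<alpha>_def)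
    show "\<alpha> < 1" using \<epsilon> P by (simp add: \<alpha>_def)
    then show "\<alpha> < 2 * s" using s by simp
  qed
  obtain c D where c: "0 < c" "0 \<le> D" and alt: "\<And>R E x0 y0. 1 \<le> R \<and> 0 < E \<and>
      E * norm (x0 - y0) powr \<alpha> + D * R powr (\<gamma> - 2) * (norm x0)\<^sup>2 < u x0 - u y0 \<Longrightarrow>
      (\<exists>x y. x \<noteq> y \<and> E * norm (x - y) powr \<alpha> \<le> u x - u y \<and> u x \<le> C * 2 powr \<gamma> * R powr \<gamma> \<and>
        f (u y) - f (u x) + c * E * norm (x - y) powr (\<alpha> - 2 * s) \<le> D * R powr (\<gamma> - 2 * s))"
    using viscosity_doubling_alternative[OF _ s(2) lL \<alpha>(1,2) op sol pos gr _ \<gamma>2] s \<gamma> C by fastforce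
  \<comment> \<open>With \<open>T = \<kappa> * R\<close> the growth bound becomes
    \<open>u x \<le> T powr \<gamma>\<close>, so the slope at \<open>T powr \<gamma>\<close> is a
    lower bound for the slopes that occur.\<close>
  define \<kappa> where "\<kappa> = (C * 2 powr \<gamma>) powr (1 / \<gamma>)"
  have \<kappa>: "0 < \<kappa>" "\<kappa> powr \<gamma> = C * 2 powr \<gamma>" using C \<gamma> by (auto simp: \<kappa>_def powr_powr)
  define B where "B = (D + 1) / (min 1 c * \<kappa> powr (\<gamma> - 2 * s))"
  have B: "0 < B" "min 1 c * B * \<kappa> powr (\<gamma> - 2 * s) = D + 1" using c \<kappa> by (auto simp: B_def)
  have "filterlim (\<lambda>T. T / \<kappa>) at_top at_top"
    unfolding filterlim_at_top
  proof
    show "\<forall>\<^sub>F T in at_top. Z \<le> T / \<kappa>" for Z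
      using eventually_ge_at_top[of "Z * \<kappa>"] by eventually_elim (use \<kappa> in \<open>simp add: field_simps\<close>)
  qed
  then have "((\<lambda>T. B * T powr (- \<epsilon>) * norm (x0 - y0) powr \<alpha> + D * (T / \<kappa>) powr (\<gamma> - 2) * (norm x0)\<^sup>2) \<longlongrightarrow>
      B * 0 * norm (x0 - y0) powr \<alpha> + D * 0 * (norm x0)\<^sup>2) at_top"
    using \<epsilon> \<gamma>2 s by (intro tendsto_intros tendsto_neg_powr filterlim_ident) auto
  then have "\<forall>\<^sub>F T in at_top. B * T powr (- \<epsilon>) * norm (x0 - y0) powr \<alpha> + D * (T / \<kappa>) powr (\<gamma> - 2) * (norm x0)\<^sup>2 < u x0 - u y0"
    using \<delta> by (intro order_tendstoD) auto
  then have "\<forall>\<^sub>F T in at_top. 1 \<le> T \<and> \<kappa> \<le> T \<and> B * T powr (- \<epsilon>) * norm (x0 - y0) powr \<alpha> + D * (T / \<kappa>) powr (\<gamma> - 2) * (norm x0)\<^sup>2 < u x0 - u y0"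
    using eventually_ge_at_top[of "1::real"] eventually_ge_at_top[of \<kappa>] by eventually_elim auto
  \<comment> \<open>The limsup supplies only arbitrarily large good radii, whereas the smallness
    conditions hold eventually; one common radius is enough.\<close>
  then obtain T where T: "N < g T" "1 \<le> T" "\<kappa> \<le> T"
    "B * T powr (- \<epsilon>) * norm (x0 - y0) powr \<alpha> + D * (T / \<kappa>) powr (\<gamma> - 2) * (norm x0)\<^sup>2 < u x0 - u y0"
    using frequently_eventually_conj[OF freq] frequently_ex by blast
  define m where "m = \<bar>deriv f (T powr \<gamma>)\<bar>"
  have gT: "1 < T powr p * m powr \<theta>" using T(1) by (simp add: N_def g_def m_def)
  \<comment> \<open>A vanishing slope is excluded because
    \<open>0 powr \<theta> = 0\<close>.\<close>
  have m: "0 < m" using gT by (cases "m = 0") (auto simp: m_def)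
  have mT: "T powr (\<gamma> - 2 * s + \<epsilon>) \<le> m powr ((2 * s - \<alpha>) / (2 * s))"
  proof -
    have a: "T powr (- p) \<le> m powr \<theta>"
      using gT T by (simp add: powr_minus field_simps)
    have e: "0 \<le> (1 - \<alpha>) / (2 * s - 1)" using \<alpha> s by simp
    have "T powr (- \<epsilon>) \<le> T powr (- ((1 - \<alpha>) * P))" using T \<alpha> by (intro powr_mono) auto
    also have "\<dots> = (T powr (- p)) powr ((1 - \<alpha>) / (2 * s - 1))"
      by (simp add: powr_powr P_def mult.commute)
    also have "\<dots> \<le> (m powr \<theta>) powr ((1 - \<alpha>) / (2 * s - 1))"
      using a e by (intro powr_mono2) auto
    also have "\<dots> = m powr ((1 - \<alpha>) / (2 * s))"
      using s by (simp add: powr_powr \<theta>_def)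
    finally have "T powr (- p) * T powr (- \<epsilon>) \<le> m powr \<theta> * m powr ((1 - \<alpha>) / (2 * s))"
      using a by (intro mult_mono) auto
    moreover have "\<theta> + (1 - \<alpha>) / (2 * s) = (2 * s - \<alpha>) / (2 * s)"
      by (simp add: \<theta>_def flip: add_divide_distrib)
    ultimately show ?thesis using \<epsilon>(2) by (simp flip: powr_add)
  qed
  define R where "R = T / \<kappa>"
  have R: "1 \<le> R" "T = \<kappa> * R" using T \<kappa> by (auto simp: R_def)
  define E where "E = B * T powr (- \<epsilon>)"
  have E: "0 < E" using B T by (simp add: E_def)
  obtain x y where xy: "x \<noteq> y" "E * norm (x - y) powr \<alpha> \<le> u x - u y" "u x \<le> C * 2 powr \<gamma> * R powr \<gamma>"
    "f (u y) - f (u x) + c * E * norm (x - y) powr (\<alpha> - 2 * s) \<le> D * R powr (\<gamma> - 2 * s)"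
    using alt[of R E x0 y0] R T E unfolding E_def R_def by blast
  have n: "0 < norm (x - y)" using xy(1) by simp
  have "0 < E * norm (x - y) powr \<alpha>" using E n by simp
  then have uy: "u y \<le> u x" using xy(2) by linarith
  have uT: "u x \<le> T powr \<gamma>" using xy(3) R \<kappa> by (simp add: powr_mult)
  have "E * (m * norm (x - y) powr \<alpha>) \<le> m * (u x - u y)"
    using mult_left_mono[OF xy(2), of m] m by (simp add: mult_ac)
  also have "\<dots> \<le> f (u y) - f (u x)"
    unfolding m_def by (rule convex_antimono_slope(1)[OF f(2,3,1) pos uy uT])
  finally have "E * (m * norm (x - y) powr \<alpha> + c * norm (x - y) powr (\<alpha> - 2 * s)) \<le> D * R powr (\<gamma> - 2 * s)"
    using xy(4) by (simp add: algebra_simps)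
  moreover have "E * (min 1 c * T powr (\<gamma> - 2 * s + \<epsilon>)) \<le> E * (m * norm (x - y) powr \<alpha> + c * norm (x - y) powr (\<alpha> - 2 * s))"
  proof -
    have "min 1 c * T powr (\<gamma> - 2 * s + \<epsilon>) \<le> min 1 c * m powr ((2 * s - \<alpha>) / (2 * s))"
      using mT c by (intro mult_left_mono) auto
    then show ?thesis
      using damped_power_lower_bound[OF m n c(1) \<alpha>(1,4)] E by (intro mult_left_mono) auto
  qed
  \<comment> \<open>The factor \<open>T powr (- \<epsilon>)\<close> in \<open>E\<close> uses up the
    remaining \<open>\<epsilon>\<close>, and \<open>B\<close> is normalised to leave
    \<open>D + 1\<close> in front.\<close>
  moreover have "E * (min 1 c * T powr (\<gamma> - 2 * s + \<epsilon>)) = (D + 1) * R powr (\<gamma> - 2 * s)"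
  proof -
    have "T powr (- \<epsilon>) * T powr (\<gamma> - 2 * s + \<epsilon>) = T powr (\<gamma> - 2 * s)"
      by (simp flip: powr_add)
    then have "T powr (- \<epsilon>) * T powr (\<gamma> - 2 * s + \<epsilon>) = \<kappa> powr (\<gamma> - 2 * s) * R powr (\<gamma> - 2 * s)"
      by (simp only: R(2) powr_mult)
    then have "E * (min 1 c * T powr (\<gamma> - 2 * s + \<epsilon>)) = min 1 c * B * \<kappa> powr (\<gamma> - 2 * s) * R powr (\<gamma> - 2 * s)"
      by (simp add: E_def mult_ac)
    then show ?thesis using B(2) by simp
  qed
  ultimately have "(D + 1) * R powr (\<gamma> - 2 * s) \<le> D * R powr (\<gamma> - 2 * s)" by linarith
  then show False using R(1) by simp
qed

section \<open>Reduction of the two growth conditions to the Liouville lemmas\<close>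

theorem theorem1p6:
  fixes s l L \<gamma> :: real
    and I :: "('a::euclidean_space \<Rightarrow> real) \<Rightarrow> 'a \<Rightarrow> real"
    and f :: "real \<Rightarrow> real"
  assumes "0 < s" and "s < 1" and "0 < l" and "l \<le> L"
    and "translation_invariant_op s I"
    and "pos_homogeneous_op s I"
    and "elliptic_op s l L I"
    and "continuous_on {0<..} f"
    and "antimono_on {0<..} f"
    and "\<gamma> < min 1 (2 * s) \<or>
         (s > 1/2 \<and> f C1_differentiable_on {0<..} \<and> convex_on {0<..} f \<and>
          (\<exists>\<beta>. 0 < \<beta> \<and> \<beta> < 1 \<and>
             Limsup at_top (\<lambda>R::real. ereal (R powr (2 * s - (2 - \<beta>) * \<gamma>) *
               \<bar>deriv f (R powr \<gamma>)\<bar> powr ((2 * s - 1) / (2 * s)))) = \<infinity>))"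
  shows "\<not> (\<exists>u :: 'a \<Rightarrow> real.
           (\<forall>x. u x > 0) \<and> \<not> u constant_on UNIV \<and>
           visc_sol s I UNIV {0<..} (\<lambda>x t p. - f t) u \<and>
           (\<exists>C. \<forall>x. \<bar>u x\<bar> \<le> C * (1 + norm x) powr \<gamma>))"
proof
  assume "\<exists>u :: 'a \<Rightarrow> real.
           (\<forall>x. u x > 0) \<and> \<not> u constant_on UNIV \<and>
           visc_sol s I UNIV {0<..} (\<lambda>x t p. - f t) u \<and>
           (\<exists>C. \<forall>x. \<bar>u x\<bar> \<le> C * (1 + norm x) powr \<gamma>)"
  then obtain u :: "'a \<Rightarrow> real" and C where pos: "\<And>x. 0 < u x" and nc: "\<not> u constant_on UNIV"
    and sol: "visc_sol s I UNIV {0<..} (\<lambda>x t p. - f t) u"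
    and gr: "\<And>x. u x \<le> C * (1 + norm x) powr \<gamma>"
    by (metis abs_le_D1)
  have C: "0 < C" using gr[of 0] pos[of 0] by simp
  have "u x \<le> u y" for x y
  proof (cases "\<gamma> < min 1 (2 * s)")
    case True
    \<comment> \<open>The given exponent may be zero or negative; enlarging it to a positive one
      below \<open>min 1 (2 * s)\<close> weakens the growth bound harmlessly, as
      \<open>1 + norm x \<ge> 1\<close>.\<close>
    define \<gamma>' where "\<gamma>' = max \<gamma> (min 1 (2 * s) / 2)"
    have \<gamma>': "0 < \<gamma>'" "\<gamma>' < min 1 (2 * s)" "\<gamma> \<le> \<gamma>'" using True assms(1) by (auto simp: \<gamma>'_def)
    have "u x \<le> C * (1 + norm x) powr \<gamma>'" for x
    proof -
      have "C * (1 + norm x) powr \<gamma> \<le> C * (1 + norm x) powr \<gamma>'"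
        using C \<gamma>' by (intro mult_left_mono powr_mono) auto
      then show ?thesis using gr[of x] by linarith
    qed
    then show ?thesis
      using liouville_sublinear[OF assms(1-5,7,9) sol pos _ \<gamma>'(1,2) C] by blast
  next
    case False
    then have s: "1/2 < s" and f: "f C1_differentiable_on {0<..}" "convex_on {0<..} f" using assms(10) by auto
    obtain \<beta> where \<beta>: "0 < \<beta>" "\<beta> < 1" "Limsup at_top (\<lambda>R::real. ereal (R powr (2 * s - (2 - \<beta>) * \<gamma>) *
               \<bar>deriv f (R powr \<gamma>)\<bar> powr ((2 * s - 1) / (2 * s)))) = \<infinity>" using assms(10) False by blast
    \<comment> \<open>For \<open>s > 1/2\<close> the minimum of 1 and \<open>2 * s\<close> is 1, so
      failure of the first condition means exactly this.\<close>
    have "1 \<le> \<gamma>" using False s by auto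
    then show ?thesis
      using liouville_damped[OF s assms(2-5,7,9) f \<beta> sol pos gr _ C] by blast
  qed
  then have "u x = u 0" for x by (meson order_antisym)
  then show False using nc unfolding constant_on_def by blast
qed

end
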